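(* Let $\tilde f\in L^2(\frac{dp}{2p},\mathbb R_+)$ and $\tilde g\in L^2(\frac{dk}{2k},\mathbb R_+)$ be two normalized wave functions such that $f(y)$ and $g(x)$ exist almost everywhere and are integrable, and such that the limit $g(0^-)=\lim_{x\to0^-}g(x)$ exists. Suppose there exist constants $\alpha>0$, $C>0$ and $L\ge0$ such that $$|f(y)|\le\frac{C}{|y|^{1+\alpha}}\qquad\text{if } y\le-L .$$ Let $f_{y_o}(y)=f(y-y_o)$. Then for both the relativistic black-hole model, $x(y)=-e^{-y}$, and the CGHS black-hole model, $x(y)=-\log(1+e^{-y})$, for all sufficiently large $y_o$, $$\big|\bar N_g[f_{y_o}]-\bar N_o[f_{y_o}]\big|\le\|g\|^2_{L^1(dx,\mathbb R_-)}\,\frac{4\,C^2}{\alpha^2\left(\frac12y_o+L\right)^{2\alpha}}+e^{2L-y_o}\,\|f\|^2_{L^1(dy,\mathbb R)}\,|g(0^-)|^2 .$$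
   Context: A wave function $\tilde f\in L^2(\frac{dp}{2p},\mathbb R_+)$ is extended by $0$ to $p<0$ and $f(y)=\frac1{\sqrt{2\pi}}\int_0^\infty\tilde f(p)e^{ipy}\,dp$; similarly for $g$. Normalized means $\int_0^\infty\frac{dp}{2p}|\tilde f(p)|^2=1$. $\langle u,v\rangle=\int_0^\infty\frac{dk}{2k}u(k)^*v(k)$. $\|g\|_{L^1(dx,\mathbb R_-)}=\int_{-\infty}^0|g(x)|\,dx$. $(U\tilde f)(k)=\frac1{\sqrt{2\pi}}\int_{-\infty}^\infty e^{-ikx(y)}f(y)\,dy$ for $k\in\mathbb R$; $(A\tilde f)(k)=(U\tilde f)(k)$ and $(B\tilde f)(k)=(U\tilde f)(-k)$ for $k>0$. $\bar N_o[f]=\int_0^\infty\frac{dk}{2k}|(U\tilde f)(-k)|^2\in[0,\infty]$ is the mean number of spontaneously created particles, and the mean number stimulated by the incoming one-particle state with wave function $g$ is $\bar N_g[f]=\bar N_o[f]+|\langle\tilde g,A\tilde f\rangle|^2+|\langle\tilde g^*,B\tilde f\rangle|^2$. The difference $\bar N_g[f]-\bar N_o[f]$ means $|\langle\tilde g,A\tilde f\rangle|^2+|\langle\tilde g^*,B\tilde f\rangle|^2$, also when both mean numbers are infinite. *)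

theory Defs
  imports "HOL-Probability.Probability"
begin

definition half_line_measure :: "real measure" where
  "half_line_measure =
     density (restrict_space lborel {0<..}) (\<lambda>k. ennreal (1 / (2 * k)))"

definition wave_inner :: "(real \<Rightarrow> complex) \<Rightarrow> (real \<Rightarrow> complex) \<Rightarrow> complex" where
  "wave_inner u v = (LINT k|half_line_measure. cnj (u k) * v k)"

definition wave_function :: "(real \<Rightarrow> complex) \<Rightarrow> bool" where
  "wave_function ft \<longleftrightarrow>
     ft \<in> borel_measurable half_line_measure \<and>
     integrable half_line_measure (\<lambda>p. (norm (ft p))\<^sup>2)"

definition normalized :: "(real \<Rightarrow> complex) \<Rightarrow> bool" where
  "normalized ft \<longleftrightarrow> (LINT p|half_line_measure. (norm (ft p))\<^sup>2) = 1"

definition schwartz :: "(real \<Rightarrow> complex) \<Rightarrow> bool" where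
  "schwartz \<phi> \<longleftrightarrow>
     (\<exists>D. D 0 = \<phi> \<and>
          (\<forall>n y. (D n has_vector_derivative D (Suc n) y) (at y)) \<and>
          (\<forall>m n. bounded (range (\<lambda>y. y ^ m *\<^sub>R D n y))))"

text \<open>
  \<open>position_space ft f\<close> expresses
  \<open>f y = 1/sqrt (2*pi) * (integral over p > 0 of ft p * cis (p * y))\<close>.
  A function that is square-integrable for \<open>dp/(2p)\<close> need not be Lebesgue integrable, so the
  integral is read as that of a tempered distribution: it is tested against Schwartz functions,
  and the relation says that the resulting distribution is the function \<open>f\<close>, which is
  thereby determined almost everywhere. When \<open>ft\<close> is Lebesgue integrable this covers the
  pointwise formula, see \<open>position_spaceI\<close> below. Values of \<open>ft\<close> at \<open>p \<le> 0\<close> play no role.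
\<close>

definition position_space :: "(real \<Rightarrow> complex) \<Rightarrow> (real \<Rightarrow> complex) \<Rightarrow> bool" where
  "position_space ft f \<longleftrightarrow>
     (\<forall>\<phi>. schwartz \<phi> \<longrightarrow>
        (LINT y|lborel. f y * \<phi> y) =
        (LINT p:{0<..}|lborel.
           ft p * (1 / complex_of_real (sqrt (2 * pi)) * (LINT y|lborel. cis (p * y) * \<phi> y))))"

definition relativistic_bh :: "real \<Rightarrow> real" where
  "relativistic_bh y = - exp (- y)"

definition cghs_bh :: "real \<Rightarrow> real" where
  "cghs_bh y = - ln (1 + exp (- y))"

text \<open>
  The operators act on a wave function through its position-space form, so they take \<open>f\<close>
  rather than \<open>ft\<close> as argument; \<open>x\<close> is the black-hole model.
\<close>

definition U_op :: "(real \<Rightarrow> real) \<Rightarrow> (real \<Rightarrow> complex) \<Rightarrow> real \<Rightarrow> complex" where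
  "U_op x f k = 1 / complex_of_real (sqrt (2 * pi)) * (LINT y|lborel. cis (- k * x y) * f y)"

definition A_op :: "(real \<Rightarrow> real) \<Rightarrow> (real \<Rightarrow> complex) \<Rightarrow> real \<Rightarrow> complex" where
  "A_op x f k = U_op x f k"

definition B_op :: "(real \<Rightarrow> real) \<Rightarrow> (real \<Rightarrow> complex) \<Rightarrow> real \<Rightarrow> complex" where
  "B_op x f k = U_op x f (- k)"

definition N_spont :: "(real \<Rightarrow> real) \<Rightarrow> (real \<Rightarrow> complex) \<Rightarrow> ennreal" where
  "N_spont x f = (\<integral>\<^sup>+ k. ennreal ((norm (U_op x f (- k)))\<^sup>2) \<partial>half_line_measure)"

text \<open>
  The number of stimulated minus the number of spontaneous particles. It is a definition of its
  own because both numbers may be infinite. If \<open>f\<close> and \<open>g\<close> are integrable, both inner products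
  converge absolutely: \<open>U_op x f\<close> is bounded, and Hardy's inequality for the integrable
  function \<open>g\<close> with positive spectrum bounds the integral of \<open>|gt k| / k\<close>.
\<close>

definition N_diff :: "(real \<Rightarrow> real) \<Rightarrow> (real \<Rightarrow> complex) \<Rightarrow> (real \<Rightarrow> complex) \<Rightarrow> real" where
  "N_diff x gt f =
     (norm (wave_inner gt (A_op x f)))\<^sup>2 +
     (norm (wave_inner (\<lambda>k. cnj (gt k)) (B_op x f)))\<^sup>2"

definition N_stim :: "(real \<Rightarrow> real) \<Rightarrow> (real \<Rightarrow> complex) \<Rightarrow> (real \<Rightarrow> complex) \<Rightarrow> ennreal" where
  "N_stim x gt f =
     N_spont x f +
     ennreal ((norm (wave_inner gt (A_op x f)))\<^sup>2) +
     ennreal ((norm (wave_inner (\<lambda>k. cnj (gt k)) (B_op x f)))\<^sup>2)"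

lemma N_stim_eq: "N_stim x gt f = N_spont x f + ennreal (N_diff x gt f)"
  by (simp add: N_stim_def N_diff_def add.assoc)

lemma N_diff_finite:
  assumes "N_spont x f < \<infinity>"
  shows "N_diff x gt f = enn2real (N_stim x gt f) - enn2real (N_spont x f)"
proof -
  have "0 \<le> N_diff x gt f" by (simp add: N_diff_def)
  then show ?thesis using assms
    by (simp add: N_stim_eq enn2real_plus)
qed

lemma schwartz_integrable:
  assumes "schwartz \<phi>"
  shows "integrable lborel \<phi>"
proof -
  obtain D where D: "D 0 = \<phi>" "\<And>n y. (D n has_vector_derivative D (Suc n) y) (at y)"
    "\<And>m n. bounded (range (\<lambda>y. y ^ m *\<^sub>R D n y))"
    using assms unfolding schwartz_def by blast
  have cont: "continuous_on UNIV \<phi>"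
    using D(1,2) by (metis continuous_at_imp_continuous_on has_vector_derivative_continuous)
  obtain K0 where K0: "\<And>y. norm (\<phi> y) \<le> K0"
    using D(3)[of 0 0] D(1) by (auto simp: bounded_iff)
  obtain K2 where K2: "\<And>y. norm (y ^ 2 *\<^sub>R \<phi> y) \<le> K2"
    using D(3)[of 2 0] D(1) by (auto simp: bounded_iff)
  have int: "integrable lborel (\<lambda>y::real. (K0 + K2) * (1 / (1 + y ^ 2)))"
    using integrable_inverse_1_plus_square
    by (intro integrable_mult_right)
       (auto simp: set_integrable_def einterval_def inverse_eq_divide)
  show ?thesis
  proof (rule Bochner_Integration.integrable_bound[OF int])
    show "\<phi> \<in> borel_measurable lborel"
      using borel_measurable_continuous_onI[OF cont] by simp
    have "norm (\<phi> y) \<le> norm ((K0 + K2) * (1 / (1 + y ^ 2)))" for y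
    proof -
      have "norm (\<phi> y) * (1 + y ^ 2) \<le> K0 + K2"
        using K0[of y] K2[of y] by (simp add: algebra_simps)
      then have "norm (\<phi> y) \<le> (K0 + K2) * (1 / (1 + y ^ 2))"
        by (simp add: pos_le_divide_eq add_pos_nonneg)
      also have "\<dots> \<le> norm ((K0 + K2) * (1 / (1 + y ^ 2)))"
        unfolding real_norm_def by (rule abs_ge_self)
      finally show ?thesis .
    qed
    then show "AE y in lborel. norm (\<phi> y) \<le> norm ((K0 + K2) * (1 / (1 + y ^ 2)))" by simp
  qed
qed

lemma position_spaceI:
  assumes ft: "set_integrable lborel {0<..} ft"
    and f: "AE y in lborel.
      f y = 1 / complex_of_real (sqrt (2 * pi)) * (LINT p:{0<..}|lborel. ft p * cis (p * y))"
    and fm: "f \<in> borel_measurable lborel"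
  shows "position_space ft f"
  unfolding position_space_def
proof (intro allI impI)
  fix \<phi> assume "schwartz \<phi>"
  then have phi: "integrable lborel \<phi>" by (rule schwartz_integrable)
  define c where "c = 1 / complex_of_real (sqrt (2 * pi))"
  define h where "h p = indicat_real {0<..} p *\<^sub>R ft p" for p
  have h: "integrable lborel h"
    using ft by (simp add: h_def[abs_def] set_integrable_def)
  have [measurable]: "h \<in> borel_measurable borel" "\<phi> \<in> borel_measurable borel"
    "f \<in> borel_measurable borel"
    using h phi fm by auto
  have cm: "continuous_on UNIV cis" by (simp add: continuous_on_cis)
  have [measurable]: "cis \<in> borel_measurable borel"
    by (rule borel_measurable_continuous_onI[OF cm])
  have prod: "integrable (lborel \<Otimes>\<^sub>M lborel) (\<lambda>(y, p). \<phi> y * h p)"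
    by (rule lborel_pair.Fubini_integrable)
       (use h phi in \<open>auto simp: norm_mult\<close>)
  have prod2: "integrable (lborel \<Otimes>\<^sub>M lborel) (\<lambda>(y, p). h p * (cis (p * y) * \<phi> y))"
    by (rule Bochner_Integration.integrable_bound[OF prod]) (auto simp: norm_mult)
  have "(LINT y|lborel. f y * \<phi> y) =
        (LINT y|lborel. c * (LINT p|lborel. h p * cis (p * y)) * \<phi> y)"
  proof (rule integral_cong_AE)
    show "AE y in lborel. f y * \<phi> y = c * (LINT p|lborel. h p * cis (p * y)) * \<phi> y"
      using f by eventually_elim (simp add: c_def h_def set_lebesgue_integral_def)
  qed measurable
  also have "\<dots> = (LINT y|lborel. c * (LINT p|lborel. h p * (cis (p * y) * \<phi> y)))"
    by (simp add: mult.assoc flip: integral_mult_left_zero)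
  also have "\<dots> = c * (LINT y|lborel. LINT p|lborel. h p * (cis (p * y) * \<phi> y))"
    by simp
  also have "\<dots> = c * (LINT p|lborel. LINT y|lborel. h p * (cis (p * y) * \<phi> y))"
    using lborel_pair.Fubini_integral[OF prod2] by simp
  also have "\<dots> = (LINT p:{0<..}|lborel. ft p * (c * (LINT y|lborel. cis (p * y) * \<phi> y)))"
    by (simp add: set_lebesgue_integral_def h_def mult_ac flip: integral_mult_right_zero)
  finally show "(LINT y|lborel. f y * \<phi> y) = (LINT p:{0<..}|lborel.
      ft p * (1 / complex_of_real (sqrt (2 * pi)) * (LINT y|lborel. cis (p * y) * \<phi> y)))"
    by (simp add: c_def)
qed

end

(*
  Write gt for the Fourier transform of g on the positive half line. Both inner products have
  the form "integral of f(y) * h(x(y))", where h is the Fourier integral of gt(k)/(2k), that is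
  h' = (i/2) g. Since f has positive frequencies only and is integrable, its integral vanishes,
  so h(x) may be replaced by h(x) - h(0), whose modulus is at most half the integral of |g|
  over [x, 0]. Splitting at y = y0/2 - L, the early part is controlled by the decay of f and
  the late part by |x(y)| <= exp(-y) and the boundedness of g near 0-.

  No inversion formula is needed: the definition of position_space, tested against smoothed
  indicator functions of [x, 0], gives the regularised h(x) - h(0) directly.
*)

theory Submission
  imports Defs
begin

section \<open>Gaussians as Schwartz functions\<close>

text \<open>Square integrability for dk/(2k) alone does not make \<open>gt k / k\<close> integrable
  near 0 or at infinity, so the k and y integrals cannot be exchanged directly. The remedy is the
  multiplier \<open>cutoff s\<close>, a difference of two Gaussians: it lies between 0 and 1,
  vanishes quadratically at 0, decays rapidly at infinity and tends to 1 at every k > 0. Gaussians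
  are chosen because the same multiplier is visible in position space: smoothing the indicator of
  [x, 0] with widths 1/s and s and subtracting multiplies its Fourier transform by exactly
  \<open>cutoff s\<close>. One parameter thus drives both sides, the position side towards the
  integral of g over [x, 0] and the momentum side towards the inner product. The vanishing of the
  integral of f is a low-frequency statement: a nonzero value of its Fourier transform at 0 would
  contradict the finiteness of the norm with weight dp/(2p).\<close>

lemma gaussian_poly_bounded:
  fixes a :: real
  assumes "a > 0"
  shows "bounded (range (\<lambda>u. poly q u * exp (- a * u\<^sup>2)))"
proof -
  \<comment> \<open>One term of the exponential series bounds
    \<open>(u ^ m)\<^sup>2 * exp (- a * u\<^sup>2)\<close> by \<open>fact m / a ^ m\<close>; the
    inequality \<open>\<bar>u ^ m\<bar> \<le> 1 + (u ^ m)\<^sup>2\<close> passes from the square to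
    \<open>u ^ m\<close> itself.\<close>
  have mono: "\<bar>u ^ m * exp (- a * u\<^sup>2)\<bar> \<le> 1 + fact m / a ^ m" for u :: real and m
  proof -
    have "(a * u\<^sup>2) ^ m / fact m \<le> exp (a * u\<^sup>2)"
    proof -
      have "(\<Sum>n\<in>{m}. (a * u\<^sup>2) ^ n /\<^sub>R fact n) \<le> exp (a * u\<^sup>2)"
        unfolding exp_def using assms
        by (intro sum_le_suminf summable_exp_generic) auto
      then show ?thesis by (simp add: field_simps)
    qed
    then have 1: "(u ^ m)\<^sup>2 * exp (- a * u\<^sup>2) \<le> fact m / a ^ m"
      using assms by (simp add: field_simps power_mult_distrib exp_minus power_mult[symmetric] mult.commute)
    have "\<bar>u ^ m\<bar> \<le> 1 + (u ^ m)\<^sup>2"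
      using zero_le_power2[of "\<bar>u ^ m\<bar> - 1"] abs_ge_zero[of "u ^ m"]
      unfolding power2_diff power2_abs one_power2 by linarith
    then have "\<bar>u ^ m * exp (- a * u\<^sup>2)\<bar> \<le> (1 + (u ^ m)\<^sup>2) * exp (- a * u\<^sup>2)"
      by (simp add: abs_mult mult_right_mono)
    also have "\<dots> \<le> 1 + fact m / a ^ m"
    proof -
      have "exp (- a * u\<^sup>2) \<le> 1" using assms by simp
      with 1 have "exp (- a * u\<^sup>2) + (u ^ m)\<^sup>2 * exp (- a * u\<^sup>2) \<le> 1 + fact m / a ^ m"
        by (rule add_mono[rotated])
      then show ?thesis by (simp add: ring_distribs)
    qed
    finally show ?thesis .
  qed
  show ?thesis
  proof -
    have "\<bar>poly q u * exp (- a * u\<^sup>2)\<bar>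
        \<le> (\<Sum>i\<le>degree q. \<bar>coeff q i\<bar> * (1 + fact i / a ^ i))" for u
    proof -
      have "poly q u * exp (- a * u\<^sup>2) =
          (\<Sum>i\<le>degree q. coeff q i * (u ^ i * exp (- a * u\<^sup>2)))"
        by (simp add: poly_altdef sum_distrib_right mult.assoc)
      also have "\<bar>\<dots>\<bar> \<le> (\<Sum>i\<le>degree q. \<bar>coeff q i * (u ^ i * exp (- a * u\<^sup>2))\<bar>)"
        by (rule sum_abs)
      also have "\<dots> \<le> (\<Sum>i\<le>degree q. \<bar>coeff q i\<bar> * (1 + fact i / a ^ i))"
        unfolding abs_mult[of "coeff q _"] by (intro sum_mono mult_left_mono mono) auto
      finally show ?thesis .
    qed
    then show ?thesis unfolding bounded_iff real_norm_def by blast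
  qed
qed

lemma schwartz_diff:
  assumes "schwartz \<phi>" "schwartz \<psi>"
  shows "schwartz (\<lambda>y. \<phi> y - \<psi> y)"
proof -
  obtain D where D: "D 0 = \<phi>" "\<And>n y. (D n has_vector_derivative D (Suc n) y) (at y)"
    "\<And>m n. bounded (range (\<lambda>y. y ^ m *\<^sub>R D n y))"
    using assms(1) unfolding schwartz_def by blast
  obtain E where E: "E 0 = \<psi>" "\<And>n y. (E n has_vector_derivative E (Suc n) y) (at y)"
    "\<And>m n. bounded (range (\<lambda>y. y ^ m *\<^sub>R E n y))"
    using assms(2) unfolding schwartz_def by blast
  show ?thesis unfolding schwartz_def
  proof (intro exI[of _ "\<lambda>n y. D n y - E n y"] conjI allI)
    fix m n
    show "bounded (range (\<lambda>y. y ^ m *\<^sub>R (D n y - E n y)))"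
      unfolding scaleR_diff_right by (rule bounded_minus_comp[OF D(3) E(3)])
  qed (use D E in \<open>auto intro!: has_vector_derivative_diff\<close>)
qed

text \<open>Made for the smoothed indicator, which is no polynomial multiple of a Gaussian, while
  its derivative is a difference of two Gaussians. Prefixing \<open>\<phi>\<close> to the derivative
  sequence of \<open>\<phi>'\<close> leaves only the decay of \<open>\<phi>\<close> itself to
  check.\<close>

lemma schwartz_of_derivative:
  assumes "schwartz \<phi>'" "\<And>y. (\<phi> has_vector_derivative \<phi>' y) (at y)"
    "\<And>m. bounded (range (\<lambda>y. y ^ m *\<^sub>R \<phi> y))"
  shows "schwartz \<phi>"
proof -
  obtain D where D: "D 0 = \<phi>'" "\<And>n y. (D n has_vector_derivative D (Suc n) y) (at y)"
    "\<And>m n. bounded (range (\<lambda>y. y ^ m *\<^sub>R D n y))"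
    using assms(1) unfolding schwartz_def by blast
  show ?thesis unfolding schwartz_def
  proof (intro exI[of _ "\<lambda>n. case n of 0 \<Rightarrow> \<phi> | Suc n \<Rightarrow> D n"] conjI allI)
  qed (use D assms in \<open>auto split: nat.splits\<close>)
qed

lemma schwartz_gaussian:
  fixes a b c :: real
  assumes "a > 0"
  shows "schwartz (\<lambda>y. complex_of_real (b * exp (- a * (y - c)\<^sup>2)))"
proof -
  \<comment> \<open>Hermite-type polynomials: the \<open>n\<close>-th derivative is
    \<open>poly (q n) u * exp (- a * u\<^sup>2)\<close> at \<open>u = y - c\<close>, and the
    recursion is the product rule.\<close>
  define q where "q = rec_nat [:b:] (\<lambda>n p. pderiv p - [:0, 2 * a:] * p)"
  have q: "q 0 = [:b:]" "\<And>n. q (Suc n) = pderiv (q n) - [:0, 2 * a:] * q n"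
    by (auto simp: q_def)
  show ?thesis unfolding schwartz_def
  proof (intro exI[of _ "\<lambda>n y. complex_of_real (poly (q n) (y - c) * exp (- a * (y - c)\<^sup>2))"] conjI allI)
    show "(\<lambda>y. complex_of_real (poly (q 0) (y - c) * exp (- a * (y - c)\<^sup>2))) =
      (\<lambda>y. complex_of_real (b * exp (- a * (y - c)\<^sup>2)))"
      by (simp add: q)
  next
    fix n y
    have "((\<lambda>y. poly (q n) (y - c) * exp (- a * (y - c)\<^sup>2)) has_real_derivative
        poly (q (Suc n)) (y - c) * exp (- a * (y - c)\<^sup>2)) (at y)"
      by (auto intro!: derivative_eq_intros poly_DERIV[THEN DERIV_chain2] simp: q algebra_simps)
    then show "((\<lambda>y. complex_of_real (poly (q n) (y - c) * exp (- a * (y - c)\<^sup>2))) has_vector_derivative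
        complex_of_real (poly (q (Suc n)) (y - c) * exp (- a * (y - c)\<^sup>2))) (at y)"
      by (intro has_vector_derivative_of_real) (simp add: has_real_derivative_iff_has_vector_derivative)
  next
    fix m n
    \<comment> \<open>In the variable \<open>u = y - c\<close> the weight \<open>y ^ m\<close> is
      the polynomial \<open>[:c, 1:] ^ m\<close>.\<close>
    obtain K where K: "\<And>u. \<bar>poly ([:c, 1:] ^ m * q n) u * exp (- a * u\<^sup>2)\<bar> \<le> K"
      using gaussian_poly_bounded[OF assms, of "[:c, 1:] ^ m * q n"] by (auto simp: bounded_iff)
    have "norm (y ^ m *\<^sub>R complex_of_real (poly (q n) (y - c) * exp (- a * (y - c)\<^sup>2))) \<le> K" for y
      using K[of "y - c"] by (simp add: norm_mult abs_mult poly_power mult_ac power_abs)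
    then show "bounded (range (\<lambda>y. y ^ m *\<^sub>R complex_of_real (poly (q n) (y - c) * exp (- a * (y - c)\<^sup>2))))"
      unfolding bounded_iff by blast
  qed
qed

lemma schwartz_normal_density:
  assumes "\<sigma> > 0"
  shows "schwartz (\<lambda>y. complex_of_real (normal_density t \<sigma> y))"
  using schwartz_gaussian[of "1 / (2 * \<sigma>\<^sup>2)" "1 / sqrt (2 * pi * \<sigma>\<^sup>2)" t] assms
  by (simp add: normal_density_def)

lemma fourier_normal_density:
  assumes "\<sigma> > 0"
  shows "(LINT y|lborel. cis (p * y) * complex_of_real (normal_density t \<sigma> y)) =
    cis (p * t) * complex_of_real (exp (- (\<sigma> * p)\<^sup>2 / 2))"
proof -
  \<comment> \<open>The substitution \<open>y = t + \<sigma> * u\<close> leads to the characteristic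
    function of the standard normal distribution at \<open>\<sigma> * p\<close>.\<close>
  have "(LINT y|lborel. cis (p * y) * complex_of_real (normal_density t \<sigma> y)) =
     \<sigma> *\<^sub>R (LINT u|lborel. cis (p * (t + \<sigma> * u)) * complex_of_real (normal_density t \<sigma> (t + \<sigma> * u)))"
    using assms lborel_integral_real_affine[of \<sigma> "\<lambda>y. cis (p * y) * complex_of_real (normal_density t \<sigma> y)" t]
    by simp
  also have "\<dots> = (LINT u|lborel. \<sigma> *\<^sub>R (cis (p * (t + \<sigma> * u)) * complex_of_real (normal_density t \<sigma> (t + \<sigma> * u))))"
    by simp
  also have "\<dots> = (LINT u|lborel. cis (p * t) * (std_normal_density u *\<^sub>R cis (\<sigma> * p * u)))"
  proof (intro Bochner_Integration.integral_cong refl)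
    fix u
    show "\<sigma> *\<^sub>R (cis (p * (t + \<sigma> * u)) * complex_of_real (normal_density t \<sigma> (t + \<sigma> * u))) =
      cis (p * t) * (std_normal_density u *\<^sub>R cis (\<sigma> * p * u))"
      using assms
      by (simp add: normal_density_def scaleR_conv_of_real real_sqrt_mult power_mult_distrib
          cis_mult[symmetric] algebra_simps)
  qed
  also have "\<dots> = cis (p * t) * (LINT u|lborel. std_normal_density u *\<^sub>R cis (\<sigma> * p * u))"
    by (rule integral_mult_right_zero)
  also have "(LINT u|lborel. std_normal_density u *\<^sub>R cis (\<sigma> * p * u)) = char std_normal_distribution (\<sigma> * p)"
    unfolding char_def
    by (subst integral_density) (auto simp: cis_conv_exp  )
  finally show ?thesis by (simp add: char_std_normal_distribution)
qed

section \<open>Wave functions on the half line\<close>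

lemma
  fixes F :: "real \<Rightarrow> 'b :: {banach, second_countable_topology}"
  assumes "F \<in> borel_measurable half_line_measure"
  shows integrable_half_line_measure: "integrable half_line_measure F \<longleftrightarrow>
      set_integrable lborel {0<..} (\<lambda>k. (1 / (2 * k)) *\<^sub>R F k)"
    and integral_half_line_measure: "integral\<^sup>L half_line_measure F =
      (LINT k:{0<..}|lborel. (1 / (2 * k)) *\<^sub>R F k)"
proof -
  have m: "F \<in> borel_measurable (restrict_space lborel {0<..})"
    using assms by (simp add: half_line_measure_def measurable_density_eq1)
  have nn: "AE k in restrict_space lborel {0<..}. 0 \<le> 1 / (2 * k :: real)"
    by (subst AE_restrict_space_iff) auto
  show "integrable half_line_measure F \<longleftrightarrow>
      set_integrable lborel {0<..} (\<lambda>k. (1 / (2 * k)) *\<^sub>R F k)"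
    unfolding half_line_measure_def set_integrable_def
    using m nn by (subst integrable_density) (auto simp: integrable_restrict_space measurable_restrict_space1)
  show "integral\<^sup>L half_line_measure F = (LINT k:{0<..}|lborel. (1 / (2 * k)) *\<^sub>R F k)"
    unfolding half_line_measure_def set_lebesgue_integral_def
    using m nn by (subst integral_density) (auto simp: integral_restrict_space measurable_restrict_space1)
qed

lemma borel_measurable_half_line_measure_iff:
  fixes F :: "real \<Rightarrow> 'b :: real_normed_vector"
  shows "F \<in> borel_measurable half_line_measure \<longleftrightarrow>
    (\<lambda>k. indicator {0<..} k *\<^sub>R F k) \<in> borel_measurable borel"
  by (simp add: half_line_measure_def measurable_density_eq1 borel_measurable_restrict_space_iff)

text \<open>The values of \<open>ft\<close> at \<open>p \<le> 0\<close> are arbitrary, so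
  \<open>ft\<close> itself may fail to be Borel measurable; the indicator is therefore kept in all
  integrands over the whole line.\<close>

lemma wave_functionD:
  assumes "wave_function ft"
  shows "(\<lambda>p. indicator {0<..} p *\<^sub>R ft p) \<in> borel_measurable borel"
    and "set_integrable lborel {0<..} (\<lambda>p. (norm (ft p))\<^sup>2 / (2 * p))"
proof -
  show "(\<lambda>p. indicator {0<..} p *\<^sub>R ft p) \<in> borel_measurable borel"
    using assms by (simp add: wave_function_def borel_measurable_half_line_measure_iff)
  have [measurable]: "ft \<in> borel_measurable half_line_measure"
    using assms by (simp add: wave_function_def)
  have "(\<lambda>p. (norm (ft p))\<^sup>2) \<in> borel_measurable half_line_measure" by measurable
  from integrable_half_line_measure[OF this] assms
  show "set_integrable lborel {0<..} (\<lambda>p. (norm (ft p))\<^sup>2 / (2 * p))"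
    by (simp add: wave_function_def)
qed

text \<open>Test with \<open>exp (- y\<^sup>2 / (2 * s\<^sup>2))\<close>, whose Fourier transform concentrates at \<open>0\<close> as
  \<open>s \<rightarrow> \<infinity>\<close>: square integrability for the weight \<open>dp/(2p)\<close>, singular at \<open>0\<close>, makes the
  momentum integral vanish in the limit.\<close>

lemma position_space_integral_zero:
  assumes wf: "wave_function ft" and ps: "position_space ft f" and f: "integrable lborel f"
  shows "(LINT y|lborel. f y) = 0"
proof -
  define s where "s n = real (Suc n)" for n
  have s: "s n > 0" for n by (simp add: s_def)
  \<comment> \<open>\<open>E n\<close> is the Fourier transform of
    \<open>normal_density 0 (s n)\<close>. It tends to 0 at every \<open>p > 0\<close>, so
    \<open>J n\<close> tends to 0 by dominated convergence.\<close>
  define E where "E n p = exp (- (s n * p)\<^sup>2 / 2)" for n p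
  define J where "J n = (LINT p:{0<..}|lborel. (norm (ft p))\<^sup>2 / (2 * p) * E n p)" for n
  have slim: "filterlim s at_top sequentially"
    unfolding s_def using filterlim_compose[OF filterlim_real_sequentially filterlim_Suc] .
  note ftm[measurable] = wave_functionD(1)[OF wf]
  have ft2: "integrable lborel (\<lambda>p. indicator {0<..} p *\<^sub>R ((norm (ft p))\<^sup>2 / (2 * p)))"
    using wave_functionD(2)[OF wf] by (simp add: set_integrable_def)
  have [measurable]: "f \<in> borel_measurable borel" using f by auto
  have [measurable]: "E n \<in> borel_measurable borel" for n unfolding E_def by measurable
  have E0: "0 \<le> E n p" "E n p \<le> 1" for n p by (auto simp: E_def)
  have Jint: "integrable lborel (\<lambda>p. indicator {0<..} p *\<^sub>R ((norm (ft p))\<^sup>2 / (2 * p) * E n p))" for n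
  proof (rule Bochner_Integration.integrable_bound[OF ft2])
    have "(\<lambda>p. (indicator {0<..} p *\<^sub>R ((norm (ft p))\<^sup>2 / (2 * p))) * E n p) \<in> borel_measurable lborel"
      using borel_measurable_integrable[OF ft2] by measurable
    then show "(\<lambda>p. indicator {0<..} p *\<^sub>R ((norm (ft p))\<^sup>2 / (2 * p) * E n p)) \<in> borel_measurable lborel"
      by (simp add: mult.assoc)
  qed (use E0 in \<open>auto simp: indicator_def abs_mult divide_simps intro!: mult_left_le\<close>)
  have J0: "J \<longlonglongrightarrow> 0"
  proof -
    have "(\<lambda>n. LINT p|lborel. indicator {0<..} p *\<^sub>R ((norm (ft p))\<^sup>2 / (2 * p) * E n p))
        \<longlonglongrightarrow> (LINT p|(lborel::real measure). 0)"
    proof (rule integral_dominated_convergence[OF _ _ ft2])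
      show "AE p in lborel. (\<lambda>n. indicator {0<..} p *\<^sub>R ((norm (ft p))\<^sup>2 / (2 * p) * E n p)) \<longlonglongrightarrow> 0"
      proof (rule AE_I2)
        fix p :: real
        show "(\<lambda>n. indicator {0<..} p *\<^sub>R ((norm (ft p))\<^sup>2 / (2 * p) * E n p)) \<longlonglongrightarrow> 0"
        proof (cases "p > 0")
          case True
          have "(\<lambda>n. E n p) \<longlonglongrightarrow> 0" unfolding E_def
            using True by (rule_tac filterlim_compose[OF _ slim]) real_asymp
          from tendsto_mult_left[OF this, of "(norm (ft p))\<^sup>2 / (2 * p)"] show ?thesis using True by simp
        qed simp
      qed
      show "AE p in lborel. norm (indicator {0<..} p *\<^sub>R ((norm (ft p))\<^sup>2 / (2 * p) * E n p))
          \<le> indicator {0<..} p *\<^sub>R ((norm (ft p))\<^sup>2 / (2 * p))" for n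
        using E0 by (auto simp: indicator_def abs_mult divide_simps intro!: mult_left_le)
    qed (use Jint in \<open>auto simp: borel_measurable_integrable\<close>)
    then show ?thesis by (simp add: J_def[abs_def] set_lebesgue_integral_def)
  qed
  \<comment> \<open>A weighted arithmetic-geometric mean inequality replaces Cauchy-Schwarz:
    \<open>norm (ft p) * s n\<close> is at most \<open>l * ((norm (ft p))\<^sup>2 / (2 * p)) + (s
    n)\<^sup>2 * p / (2 * l)\<close>. For fixed \<open>l\<close> the limit in \<open>n\<close>
    removes the \<open>J\<close> term; afterwards \<open>l\<close> may be taken arbitrarily
    large.\<close>
  have bound: "norm (LINT y|lborel. f y * complex_of_real (exp (- y\<^sup>2 / (2 * (s n)\<^sup>2))))
      \<le> l * J n + 1 / l" if l: "l > 0" for l n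
  proof -
    define c where "c = complex_of_real (s n * sqrt (2 * pi))"
    define m where "m p = normal_density 0 (1 / s n) p * \<bar>p\<bar>" for p
    define R where "R p = l * (indicator {0<..} p *\<^sub>R ((norm (ft p))\<^sup>2 / (2 * p) * E n p))
        + 1 / (2 * l) * (s n * sqrt (2 * pi) * m p)" for p
    define F where "F p = indicator {0<..} p *\<^sub>R (ft p * complex_of_real (s n * E n p))" for p
    \<comment> \<open>The first absolute moment over the whole line; with it the second summand of
      \<open>R\<close> integrates to exactly \<open>1 / l\<close>.\<close>
    have m: "has_bochner_integral lborel m (1 / s n * sqrt (2 / pi))"
      using normal_moment_abs_odd[of "1 / s n" 0 0] s[of n] by (simp add: m_def[abs_def])
    have R: "integrable lborel R"
      unfolding R_def using m
      by (intro Bochner_Integration.integrable_add integrable_mult_right Jint) (rule integrable.intros)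
    have le: "norm (F p) \<le> R p" for p
    proof (cases "p > 0")
      case True
      have nd: "s n * sqrt (2 * pi) * m p = (s n)\<^sup>2 * p * E n p"
        using s[of n] True by (simp add: m_def normal_density_def E_def real_sqrt_mult real_sqrt_divide field_simps power2_eq_square)
      have "norm (ft p) * s n \<le> l * ((norm (ft p))\<^sup>2 / (2 * p)) + 1 / (2 * l) * ((s n)\<^sup>2 * p)"
      proof -
        have "0 \<le> (l * norm (ft p) - s n * p)\<^sup>2" by simp
        then show ?thesis using True l by (simp add: field_simps power2_eq_square)
      qed
      from mult_right_mono[OF this E0(1)[of n p]] show ?thesis
        unfolding R_def nd using True s[of n] E0(1)[of n p] by (simp add: F_def norm_mult algebra_simps)
    next
      case False
      moreover have "0 \<le> 1 / (2 * l) * (s n * sqrt (2 * pi) * m p)"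
        using l s[of n] by (intro mult_nonneg_nonneg) (auto simp: m_def)
      ultimately show ?thesis by (simp add: R_def F_def)
    qed
    have "(\<lambda>p. (indicator {0<..} p *\<^sub>R ft p) * complex_of_real (s n * E n p)) \<in> borel_measurable borel"
      by measurable
    then have Fm: "F \<in> borel_measurable lborel"
      by (simp add: F_def[abs_def])
    have F: "integrable lborel F"
      by (rule Bochner_Integration.integrable_bound[OF R Fm]) (use order_trans[OF le abs_ge_self] in simp)
    have "(LINT y|lborel. f y * complex_of_real (exp (- y\<^sup>2 / (2 * (s n)\<^sup>2)))) =
        c * (LINT y|lborel. f y * complex_of_real (normal_density 0 (s n) y))"
      unfolding integral_mult_right_zero[symmetric]
      using s[of n] by (intro Bochner_Integration.integral_cong refl)
        (simp add: c_def normal_density_def real_sqrt_mult field_simps)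
    also have "(LINT y|lborel. f y * complex_of_real (normal_density 0 (s n) y)) =
      (LINT p:{0<..}|lborel. ft p * (1 / complex_of_real (sqrt (2 * pi)) * complex_of_real (E n p)))"
      using ps schwartz_normal_density[OF s[of n], of 0] s[of n]
      by (simp add: position_space_def fourier_normal_density E_def)
    also have "c * \<dots> = integral\<^sup>L lborel F"
      unfolding set_lebesgue_integral_def integral_mult_right_zero[symmetric]
      by (intro Bochner_Integration.integral_cong refl) (simp add: F_def c_def scaleR_conv_of_real)
    also have "norm \<dots> \<le> integral\<^sup>L lborel R"
      by (rule order_trans[OF integral_norm_bound integral_mono[OF integrable_norm[OF F] R le]])
    also have "\<dots> = l * J n + 1 / (2 * l) * (s n * sqrt (2 * pi) * (1 / s n * sqrt (2 / pi)))"
    proof -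
      have "integral\<^sup>L lborel R = (LINT p|lborel. l * (indicator {0<..} p *\<^sub>R ((norm (ft p))\<^sup>2 / (2 * p) * E n p)))
          + (LINT p|lborel. 1 / (2 * l) * (s n * sqrt (2 * pi) * m p))"
        unfolding R_def[abs_def]
        by (intro Bochner_Integration.integral_add integrable_mult_right Jint) (rule integrable.intros[OF m])
      then show ?thesis
        unfolding integral_mult_right_zero has_bochner_integral_integral_eq[OF m] J_def set_lebesgue_integral_def .
    qed
    also have "\<dots> = l * J n + 1 / l"
      using s[of n] l by (simp add: real_sqrt_divide real_sqrt_mult field_simps)
    finally show ?thesis .
  qed
  have lim: "(\<lambda>n. LINT y|lborel. f y * complex_of_real (exp (- y\<^sup>2 / (2 * (s n)\<^sup>2))))
      \<longlonglongrightarrow> (LINT y|lborel. f y)"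
  proof (rule integral_dominated_convergence[where w = "\<lambda>y. norm (f y)"])
    show "AE y in lborel. (\<lambda>n. f y * complex_of_real (exp (- y\<^sup>2 / (2 * (s n)\<^sup>2)))) \<longlonglongrightarrow> f y"
    proof (rule AE_I2)
      fix y
      have "(\<lambda>n. exp (- y\<^sup>2 / (2 * (s n)\<^sup>2))) \<longlonglongrightarrow> 1"
        by (rule filterlim_compose[OF _ slim]) real_asymp
      from tendsto_mult_left[OF tendsto_of_real[OF this], of "f y"]
      show "(\<lambda>n. f y * complex_of_real (exp (- y\<^sup>2 / (2 * (s n)\<^sup>2)))) \<longlonglongrightarrow> f y" by simp
    qed
  qed (use f in \<open>simp_all add: norm_mult mult_left_le\<close>)
  have "norm (LINT y|lborel. f y) \<le> 1 / l" if "l > 0" for l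
  proof (rule LIMSEQ_le[OF tendsto_norm[OF lim]])
    show "(\<lambda>n. l * J n + 1 / l) \<longlonglongrightarrow> 1 / l"
      using tendsto_add[OF tendsto_mult_left[OF J0, of l] tendsto_const[of "1 / l"]] by simp
  qed (use bound that in auto)
  from this[of "1 / e" for e] have "norm (LINT y|lborel. f y) \<le> e" if "e > 0" for e
    using that by simp
  then have "norm (LINT y|lborel. f y) \<le> 0" by (rule field_le_epsilon) simp
  then show ?thesis by simp
qed

section \<open>Smoothed indicator functions\<close>

text \<open>The convolution of the indicator of \<open>{x..0}\<close> with a centred Gaussian of
  width \<open>\<sigma>\<close>. Unlike the indicator it is a Schwartz function for
  \<open>\<sigma> > 0\<close> and \<open>x \<le> 0\<close>, hence admissible in
  \<open>position_space\<close>.\<close>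

definition smoothed_indicator :: "real \<Rightarrow> real \<Rightarrow> real \<Rightarrow> real" where
  "smoothed_indicator \<sigma> x y = (LINT t:{x..0}|lborel. normal_density t \<sigma> y)"

lemma integrable_const_Icc: "integrable lborel (\<lambda>t. indicator {a..b :: real} t *\<^sub>R (c :: 'a :: {banach, second_countable_topology}))"
  by (intro integrable_scaleR_left integrable_real_indicator) (auto simp: emeasure_lborel_Icc_eq)

lemma normal_density_commute: "normal_density t \<sigma> y = normal_density y \<sigma> t"
  by (simp add: normal_density_def power2_commute)

lemma smoothed_indicator_bounds:
  assumes "\<sigma> > 0"
  shows "0 \<le> smoothed_indicator \<sigma> x y" "smoothed_indicator \<sigma> x y \<le> 1"
proof -
  have eq: "smoothed_indicator \<sigma> x y = (LINT t|lborel. indicator {x..0} t * normal_density y \<sigma> t)"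
    unfolding smoothed_indicator_def set_lebesgue_integral_def by (simp add: normal_density_commute[of _ _ y])
  show "0 \<le> smoothed_indicator \<sigma> x y" unfolding eq by (intro integral_nonneg_AE) auto
  have "(LINT t|lborel. indicator {x..0} t * normal_density y \<sigma> t) \<le> (LINT t|lborel. normal_density y \<sigma> t)"
    using assms by (intro integral_mono') (auto simp: indicator_def)
  then show "smoothed_indicator \<sigma> x y \<le> 1" using assms by (simp add: eq)
qed

text \<open>For \<open>x < 0\<close> the limit at either end point is 1/2 instead of 1. The two
  excluded points form a null set, which is all that the later integrals see.\<close>

lemma smoothed_indicator_narrow:
  assumes "y \<noteq> x" "y \<noteq> 0"
  shows "(\<lambda>n. smoothed_indicator (1 / real (Suc n)) x y) \<longlonglongrightarrow> indicator {x..0} y"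
proof -
  define s where "s n = 1 / real (Suc n)" for n
  have s: "s n > 0" for n by (simp add: s_def)
  \<comment> \<open>Rescaling moves the width from the density into the argument of the indicator,
    so that the fixed majorant \<open>std_normal_density\<close> serves for all
    \<open>n\<close>.\<close>
  have eq: "smoothed_indicator (s n) x y =
      (LINT u|lborel. std_normal_density u * indicator {x..0} (y + s n * u))" for n
  proof -
    have "smoothed_indicator (s n) x y = (LINT t|lborel. indicator {x..0} t * normal_density y (s n) t)"
      unfolding smoothed_indicator_def set_lebesgue_integral_def by (simp add: normal_density_commute[of _ _ y])
    also have "\<dots> = s n * (LINT u|lborel. indicator {x..0} (y + s n * u) * normal_density y (s n) (y + s n * u))"
      using s[of n] by (subst lborel_integral_real_affine[of "s n" _ y]) auto
    also have "\<dots> = (LINT u|lborel. std_normal_density u * indicator {x..0} (y + s n * u))"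
      unfolding integral_mult_right_zero[symmetric] using s[of n]
      by (intro Bochner_Integration.integral_cong refl)
        (simp add: normal_density_def real_sqrt_mult power_mult_distrib)
    finally show ?thesis .
  qed
  have slim: "s \<longlonglongrightarrow> 0" unfolding s_def by (rule LIMSEQ_Suc[OF lim_1_over_n])
  have "(\<lambda>n. LINT u|lborel. std_normal_density u * indicator {x..0} (y + s n * u))
      \<longlonglongrightarrow> (LINT u|lborel. std_normal_density u * indicator {x..0} y)"
  proof (rule integral_dominated_convergence[where w = std_normal_density])
    show "AE u in lborel. (\<lambda>n. std_normal_density u * indicator {x..0} (y + s n * u))
       \<longlonglongrightarrow> std_normal_density u * indicator {x..0} y"
    proof (rule AE_I2)
      fix u
      have "isCont (indicator {x..0} :: real \<Rightarrow> real) y"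
        using assms frontier_cbox[of x "0 :: real"]
        by (auto simp: isCont_indicator cbox_interval box_real split: if_splits)
      moreover have "(\<lambda>n. y + s n * u) \<longlonglongrightarrow> y"
        using tendsto_add[OF tendsto_const[of y] tendsto_mult_right[OF slim, of u]] by simp
      ultimately show "(\<lambda>n. std_normal_density u * indicator {x..0} (y + s n * u))
         \<longlonglongrightarrow> std_normal_density u * indicator {x..0} y"
        by (rule tendsto_mult_left[OF isCont_tendsto_compose])
    qed
  qed (auto simp: indicator_def)
  then have "(\<lambda>n. smoothed_indicator (s n) x y) \<longlonglongrightarrow> indicator {x..0} y" by (simp add: eq)
  then show ?thesis by (simp add: s_def)
qed

text \<open>A normal density of width \<open>s\<close> never exceeds \<open>1 / s\<close>, so its
  mass on the fixed interval is at most \<open>\<bar>x\<bar> / s\<close>.\<close>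

lemma smoothed_indicator_wide:
  "(\<lambda>n. smoothed_indicator (real (Suc n)) x y) \<longlonglongrightarrow> 0"
proof (rule tendsto_sandwich[OF always_eventually always_eventually tendsto_const])
  show "\<forall>n. 0 \<le> smoothed_indicator (real (Suc n)) x y"
    by (intro allI smoothed_indicator_bounds) simp
  show "\<forall>n. smoothed_indicator (real (Suc n)) x y \<le> \<bar>x\<bar> * (1 / real (Suc n))"
  proof
    fix n
    have nd: "normal_density t (real (Suc n)) y \<le> 1 / real (Suc n)" for t
    proof -
      have "1 \<le> sqrt (2 * pi)" using pi_ge_two by simp
      then have "real (Suc n) * 1 \<le> real (Suc n) * sqrt (2 * pi)" by (intro mult_left_mono) auto
      then have "real (Suc n) \<le> sqrt (2 * pi * (real (Suc n))\<^sup>2)"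
        by (simp add: real_sqrt_mult mult.commute del: of_nat_Suc)
      then have "1 / sqrt (2 * pi * (real (Suc n))\<^sup>2) \<le> 1 / real (Suc n)"
        by (intro divide_left_mono) auto
      then have "1 / sqrt (2 * pi * (real (Suc n))\<^sup>2) * exp (- (y - t)\<^sup>2 / (2 * (real (Suc n))\<^sup>2)) \<le> 1 / real (Suc n) * 1"
        by (intro mult_mono) auto
      then show ?thesis by (simp add: normal_density_def)
    qed
    have "smoothed_indicator (real (Suc n)) x y \<le> (LINT t:{x..0}|lborel. 1 / real (Suc n))"
      unfolding smoothed_indicator_def set_lebesgue_integral_def
      using nd by (intro integral_mono' integrable_const_Icc) (auto simp: indicator_def simp del: of_nat_Suc)
    also have "\<dots> \<le> \<bar>x\<bar> * (1 / real (Suc n))"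
      unfolding set_lebesgue_integral_def by (cases "x \<le> 0") (auto)
    finally show "smoothed_indicator (real (Suc n)) x y \<le> \<bar>x\<bar> * (1 / real (Suc n))" .
  qed
  show "(\<lambda>n. \<bar>x\<bar> * (1 / real (Suc n))) \<longlonglongrightarrow> 0"
    using tendsto_mult_left[OF LIMSEQ_Suc[OF lim_1_over_n], of "\<bar>x\<bar>"] by simp
qed

text \<open>With a primitive \<open>F\<close> of the standard normal density, the smoothed indicator
  is \<open>F ((0 - y) / \<sigma>) - F ((x - y) / \<sigma>)\<close>, and each end point contributes
  one Gaussian to the derivative.\<close>

lemma smoothed_indicator_has_derivative:
  assumes "\<sigma> > 0" "x \<le> 0"
  shows "(smoothed_indicator \<sigma> x has_real_derivative normal_density x \<sigma> y - normal_density 0 \<sigma> y) (at y)"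
proof -
  have "isCont std_normal_density t" for t
    unfolding std_normal_density_def by (intro continuous_intros) auto
  then obtain F where F: "\<And>t. (F has_real_derivative std_normal_density t) (at t)"
    using einterval_antiderivative[of "-\<infinity>" "\<infinity>" std_normal_density]
    by (auto simp: has_real_derivative_iff_has_vector_derivative)
  have nd: "std_normal_density ((t - y) / \<sigma>) / \<sigma> = normal_density t \<sigma> y" for t y
    using assms by (simp add: normal_density_def real_sqrt_mult power_divide power2_commute[of t y])
  have eq: "smoothed_indicator \<sigma> x y = F ((0 - y) / \<sigma>) - F ((x - y) / \<sigma>)" for y
    unfolding smoothed_indicator_def set_lebesgue_integral_def
  proof (rule integral_FTC_Icc[OF assms(2)])
    fix t
    have "((\<lambda>t. F ((t - y) / \<sigma>)) has_real_derivative normal_density t \<sigma> y) (at t)"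
    proof -
      have "((\<lambda>t. (t - y) / \<sigma>) has_real_derivative 1 / \<sigma>) (at t)"
        using assms by (auto intro!: derivative_eq_intros)
      from DERIV_chain2[OF F this] show ?thesis by (simp add: nd)
    qed
    then show "((\<lambda>t. F ((t - y) / \<sigma>)) has_vector_derivative normal_density t \<sigma> y) (at t within {x..0})"
      by (simp add: has_real_derivative_iff_has_vector_derivative has_vector_derivative_at_within)
  next
    show "continuous_on {x..0} (\<lambda>t. normal_density t \<sigma> y)"
      unfolding normal_density_def using assms by (intro continuous_intros) auto
  qed
  have "((\<lambda>y. F ((t - y) / \<sigma>)) has_real_derivative - normal_density t \<sigma> y) (at y)" for t
  proof -
    have "((\<lambda>y. (t - y) / \<sigma>) has_real_derivative - 1 / \<sigma>) (at y)"
      using assms by (auto intro!: derivative_eq_intros)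
    from DERIV_chain2[OF F this] show ?thesis by (simp add: nd[symmetric])
  qed
  from DERIV_diff[OF this[of 0] this[of x]] show ?thesis
    by (simp add: eq[abs_def])
qed

lemma schwartz_smoothed_indicator:
  assumes s: "\<sigma> > 0" and x: "x \<le> 0"
  shows "schwartz (\<lambda>y. complex_of_real (smoothed_indicator \<sigma> x y))"
proof (rule schwartz_of_derivative)
  show "schwartz (\<lambda>y. complex_of_real (normal_density x \<sigma> y) - complex_of_real (normal_density 0 \<sigma> y))"
    by (intro schwartz_diff schwartz_normal_density s)
  show "((\<lambda>y. complex_of_real (smoothed_indicator \<sigma> x y)) has_vector_derivative
      complex_of_real (normal_density x \<sigma> y) - complex_of_real (normal_density 0 \<sigma> y)) (at y)" for y
    using has_vector_derivative_of_real[OF smoothed_indicator_has_derivative[OF assms, of y]] by simp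
  fix m
  define b where "b = 1 / sqrt (2 * pi * \<sigma>\<^sup>2)"
  define a where "a = 1 / (2 * \<sigma>\<^sup>2)"
  have b: "b > 0" using s by (simp add: b_def)
  have nd: "normal_density t \<sigma> y = b * exp (- a * (y - t)\<^sup>2)" for t y
    by (simp add: normal_density_def a_def b_def)
  \<comment> \<open>For \<open>t\<close> in \<open>{x..0}\<close> one has
    \<open>\<bar>y\<bar> \<le> (y - t)\<^sup>2 + (1 - x)\<close>. The right side is a polynomial in
    \<open>y - t\<close> whose coefficients do not depend on \<open>t\<close>, so one constant
    \<open>K\<close> serves the whole interval.\<close>
  obtain K where K: "\<And>u. \<bar>poly ([:1 - x, 0, 1:] ^ m) u * exp (- a * u\<^sup>2)\<bar> \<le> K"
    using gaussian_poly_bounded[of a "[:1 - x, 0, 1:] ^ m"] s by (auto simp: bounded_iff a_def)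
  have pt: "\<bar>y\<bar> ^ m * normal_density t \<sigma> y \<le> b * K" if t: "t \<in> {x..0}" for t y
  proof -
    have "\<bar>y - t\<bar> \<le> 1 + (y - t)\<^sup>2"
    proof (cases "\<bar>y - t\<bar> \<le> 1")
      case False
      then have "\<bar>y - t\<bar> * 1 \<le> \<bar>y - t\<bar> * \<bar>y - t\<bar>" by (intro mult_left_mono) auto
      then show ?thesis by (simp add: power2_eq_square abs_mult[symmetric])
    qed (use zero_le_power2[of "y - t"] in linarith)
    then have "\<bar>y\<bar> \<le> (y - t)\<^sup>2 + (1 - x)" using t by auto
    then have "\<bar>y\<bar> ^ m \<le> ((y - t)\<^sup>2 + (1 - x)) ^ m" by (intro power_mono) auto
    then have "\<bar>y\<bar> ^ m * exp (- a * (y - t)\<^sup>2) \<le> ((y - t)\<^sup>2 + (1 - x)) ^ m * exp (- a * (y - t)\<^sup>2)"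
      by (intro mult_right_mono) auto
    also have "\<dots> \<le> \<bar>poly ([:1 - x, 0, 1:] ^ m) (y - t) * exp (- a * (y - t)\<^sup>2)\<bar>"
      by (rule order_trans[OF _ abs_ge_self]) (simp add: poly_power power2_eq_square algebra_simps)
    also have "\<dots> \<le> K" by (rule K)
    finally have "b * (\<bar>y\<bar> ^ m * exp (- a * (y - t)\<^sup>2)) \<le> b * K" using b by (intro mult_left_mono) auto
    then show ?thesis by (simp add: nd mult_ac)
  qed
  have bK: "0 \<le> b * K"
    using K[of 0] b by (intro mult_nonneg_nonneg) auto
  have "norm (y ^ m *\<^sub>R complex_of_real (smoothed_indicator \<sigma> x y)) \<le> - x * (b * K)" for y
  proof -
    have "norm (y ^ m *\<^sub>R complex_of_real (smoothed_indicator \<sigma> x y)) = \<bar>y\<bar> ^ m * smoothed_indicator \<sigma> x y"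
      using smoothed_indicator_bounds(1)[OF s] by (simp add: power_abs)
    also have "\<dots> = (LINT t:{x..0}|lborel. \<bar>y\<bar> ^ m * normal_density t \<sigma> y)"
      unfolding smoothed_indicator_def by simp
    also have "\<dots> \<le> (LINT t:{x..0}|lborel. b * K)"
      unfolding set_lebesgue_integral_def
      using pt bK by (intro integral_mono' integrable_const_Icc) (auto simp: indicator_def)
    also have "\<dots> = - x * (b * K)" using x by (simp add: set_lebesgue_integral_def)
    finally show ?thesis .
  qed
  then show "bounded (range (\<lambda>y. y ^ m *\<^sub>R complex_of_real (smoothed_indicator \<sigma> x y)))"
    unfolding bounded_iff by blast
qed

section \<open>Fourier transforms of intervals and of their smoothings\<close>

lemma borel_measurable_cis[measurable]: "cis \<in> borel_measurable borel"
  by (rule borel_measurable_continuous_onI) (simp add: continuous_on_cis)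

text \<open>The transform of a convolution is a product: the Gaussian factor of
  \<open>fourier_normal_density\<close> is independent of the centre \<open>t\<close> and leaves the
  integral over \<open>t\<close>.\<close>

lemma fourier_smoothed_indicator:
  assumes s: "\<sigma> > 0"
  shows "(LINT y|lborel. cis (p * y) * complex_of_real (smoothed_indicator \<sigma> x y)) =
    complex_of_real (exp (- (\<sigma> * p)\<^sup>2 / 2)) * (LINT t:{x..0}|lborel. cis (p * t))"
proof -
  have [measurable]: "(\<lambda>z. normal_density (fst z) \<sigma> (snd z)) \<in> borel_measurable (borel \<Otimes>\<^sub>M borel)"
    unfolding normal_density_def by measurable
  define H where "H t y = indicator {x..0} t *\<^sub>R (cis (p * y) * complex_of_real (normal_density t \<sigma> y))" for t y
  have Hm: "(\<lambda>(t, y). H t y) \<in> borel_measurable (lborel \<Otimes>\<^sub>M lborel)"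
  proof -
    have "(\<lambda>z. indicator {x..0} (fst z) *\<^sub>R (cis (p * snd z) * complex_of_real (normal_density (fst z) \<sigma> (snd z))))
      \<in> borel_measurable (lborel \<Otimes>\<^sub>M lborel)" by measurable
    then show ?thesis by (simp add: H_def split_beta')
  qed
  have nd: "integrable lborel (\<lambda>y. normal_density t \<sigma> y)" for t using s by simp
  have Hy: "integrable lborel (H t)" for t
  proof (rule Bochner_Integration.integrable_bound[OF nd[of t]])
    show "H t \<in> borel_measurable lborel" unfolding H_def by measurable
  qed (auto simp: H_def norm_mult indicator_def)
  have prod: "integrable (lborel \<Otimes>\<^sub>M lborel) (\<lambda>(t, y). H t y)"
  proof (rule lborel_pair.Fubini_integrable[OF Hm])
    have "(\<lambda>t. LINT y|lborel. norm (H t y)) = (\<lambda>t. indicator {x..0} t)"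
      using s by (auto simp: H_def norm_mult indicator_def fun_eq_iff)
    then show "integrable lborel (\<lambda>t. LINT y|lborel. norm (case (t, y) of (t, y) \<Rightarrow> H t y))"
      using integrable_const_Icc[of x 0 "1 :: real"] by simp
  qed (use Hy in simp)
  have "(LINT y|lborel. cis (p * y) * complex_of_real (smoothed_indicator \<sigma> x y)) =
      (LINT y|lborel. LINT t|lborel. H t y)"
    unfolding smoothed_indicator_def set_lebesgue_integral_def H_def
    by (simp add: mult.left_commute scaleR_conv_of_real flip: integral_complex_of_real integral_mult_right_zero)
  also have "\<dots> = (LINT t|lborel. LINT y|lborel. H t y)"
    using lborel_pair.Fubini_integral[OF prod] by simp
  also have "\<dots> = (LINT t|lborel. indicator {x..0} t *\<^sub>R (cis (p * t) * complex_of_real (exp (- (\<sigma> * p)\<^sup>2 / 2))))"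
    unfolding H_def by (simp add: fourier_normal_density[OF s])
  also have "\<dots> = complex_of_real (exp (- (\<sigma> * p)\<^sup>2 / 2)) * (LINT t:{x..0}|lborel. cis (p * t))"
    unfolding set_lebesgue_integral_def integral_mult_right_zero[symmetric]
    by (intro Bochner_Integration.integral_cong refl) (simp add: mult.commute)
  finally show ?thesis .
qed

text \<open>Read from right to left: \<open>cis (p * x) - 1\<close> divided by \<open>p\<close>,
  which the weight dp/(2p) produces once the value at 0 is subtracted, is a Fourier integral over
  \<open>{x..0}\<close>.\<close>

lemma integral_cis_interval:
  assumes "x \<le> 0" "p \<noteq> 0"
  shows "(LINT t:{x..0}|lborel. cis (p * t)) = (1 - cis (p * x)) / (\<i> * of_real p)"
proof -
  have "(LINT t|lborel. indicator {x..0} t *\<^sub>R cis (p * t)) =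
    cis (p * 0) / (\<i> * of_real p) - cis (p * x) / (\<i> * of_real p)"
  proof (rule integral_FTC_Icc[OF assms(1)])
    fix t
    show "((\<lambda>t. cis (p * t) / (\<i> * of_real p)) has_vector_derivative cis (p * t)) (at t within {x..0})"
      unfolding cis_conv_exp using assms(2)
      by (auto intro!: derivative_eq_intros has_vector_derivative_real_field simp: field_simps)
  next
    show "continuous_on {x..0} (\<lambda>t. cis (p * t))" by (intro continuous_intros)
  qed
  then show ?thesis by (simp add: set_lebesgue_integral_def diff_divide_distrib)
qed

section \<open>Regularised primitives of positive-frequency functions\<close>

lemma borel_measurable_integral_Icc:
  fixes g :: "real \<Rightarrow> 'b :: {banach, second_countable_topology}"
  assumes [measurable]: "g \<in> borel_measurable borel" "X \<in> borel_measurable borel"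
  shows "(\<lambda>y. LINT s:{X y..0}|lborel. g s) \<in> borel_measurable borel"
proof -
  \<comment> \<open>Written as inequalities between measurable functions of the pair, membership in
    the moving interval is jointly measurable.\<close>
  have "(\<lambda>z. (if X (fst z) \<le> snd z \<and> snd z \<le> 0 then 1 else 0 :: real) *\<^sub>R g (snd z))
      \<in> borel_measurable (borel \<Otimes>\<^sub>M lborel)" by measurable
  then have "(\<lambda>(y, s). indicator {X y..0} s *\<^sub>R g s) \<in> borel_measurable (borel \<Otimes>\<^sub>M lborel)"
    by (rule measurable_cong[THEN iffD1, rotated]) (auto simp: indicator_def)
  from lborel.borel_measurable_lebesgue_integral[OF this]
  show ?thesis by (simp add: set_lebesgue_integral_def)
qed

text \<open>The Fourier factor of the narrow smoothing minus that of the wide one. The first gives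
  decay at infinity; subtracting the second gives a zero of second order at
  \<open>k = 0\<close>.\<close>

definition cutoff :: "real \<Rightarrow> real \<Rightarrow> real" where
  "cutoff s k = exp (- (1 / s * k)\<^sup>2 / 2) - exp (- (s * k)\<^sup>2 / 2)"

lemma borel_measurable_cutoff[measurable]: "cutoff s \<in> borel_measurable borel"
  unfolding cutoff_def by measurable

lemma
  assumes "s \<ge> 1"
  shows cutoff_nonneg: "0 \<le> cutoff s k" and cutoff_le_1: "cutoff s k \<le> 1"
    and cutoff_le: "cutoff s k \<le> (s * k)\<^sup>2 / 2 * exp (- (1 / s * k)\<^sup>2 / 2)"
proof -
  define a where "a = (1 / s * k)\<^sup>2 / 2"
  define b where "b = (s * k)\<^sup>2 / 2"
  have eq: "cutoff s k = exp (- a) - exp (- b)" by (simp add: cutoff_def a_def b_def)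
  have "1 / s \<le> s" using assms by (simp add: divide_le_eq) (metis mult_mono' order_trans mult_1 zero_le_one)
  then have "(1 / s)\<^sup>2 \<le> s\<^sup>2" using assms by (intro power_mono) auto
  then have ab: "a \<le> b"
    unfolding a_def b_def power_mult_distrib by (intro divide_right_mono mult_right_mono) auto
  have a0: "0 \<le> a" by (simp add: a_def)
  show "0 \<le> cutoff s k" using ab by (simp add: eq)
  have "exp (- a) \<le> 1" using a0 by simp
  then show "cutoff s k \<le> 1" using exp_gt_zero[of "- b"] unfolding eq by linarith
  \<comment> \<open>Factoring out \<open>exp (- a)\<close> and using
    \<open>1 - exp (- t) \<le> t\<close> yields the quadratic zero and the Gaussian decay in one
    bound.\<close>
  have "exp (- a) - exp (- b) = exp (- a) * (1 - exp (- (b - a)))"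
    by (simp add: algebra_simps flip: exp_add)
  also have "\<dots> \<le> exp (- a) * b"
    using exp_ge_add_one_self[of "- (b - a)"] a0 by (intro mult_left_mono exp_ge_zero) linarith
  finally show "cutoff s k \<le> (s * k)\<^sup>2 / 2 * exp (- (1 / s * k)\<^sup>2 / 2)"
    by (simp add: eq a_def b_def mult.commute)
qed

text \<open>An approximation of the integral of \<open>g\<close> over \<open>{x..0}\<close> as
  \<open>s\<close> grows. The wide smoothing tends to 0 and is subtracted for its effect at low
  momentum.\<close>

definition smoothed_primitive :: "(real \<Rightarrow> complex) \<Rightarrow> real \<Rightarrow> real \<Rightarrow> complex" where
  "smoothed_primitive g s x =
    (LINT y|lborel. g y * complex_of_real (smoothed_indicator (1 / s) x y - smoothed_indicator s x y))"

text \<open>Through this identity the relation between \<open>gt\<close> and \<open>g\<close>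
  enters: \<open>position_space\<close> is tested with the difference of the two smoothings, whose
  transform is \<open>cutoff s\<close> times that of the interval.\<close>

lemma smoothed_primitive_eq:
  assumes ps: "position_space gt g" and s: "s > 0" and x: "x \<le> 0"
  shows "smoothed_primitive g s x = (LINT p:{0<..}|lborel. gt p *
    (1 / complex_of_real (sqrt (2 * pi)) * (of_real (cutoff s p) * (LINT t:{x..0}|lborel. cis (p * t)))))"
proof -
  define u where "u \<sigma> y = complex_of_real (smoothed_indicator \<sigma> x y)" for \<sigma> y
  have sch: "schwartz (u \<sigma>)" if "\<sigma> > 0" for \<sigma>
    unfolding u_def by (rule schwartz_smoothed_indicator[OF that x])
  have int: "integrable lborel (\<lambda>y. cis (p * y) * u \<sigma> y)" if "\<sigma> > 0" for \<sigma> p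
  proof (rule Bochner_Integration.integrable_bound[OF schwartz_integrable[OF sch[OF that]]])
    have [measurable]: "u \<sigma> \<in> borel_measurable borel" using schwartz_integrable[OF sch[OF that]] by auto
    show "(\<lambda>y. cis (p * y) * u \<sigma> y) \<in> borel_measurable lborel" by measurable
  qed (simp add: norm_mult)
  have FT: "(LINT y|lborel. cis (p * y) * (u (1 / s) y - u s y)) =
      of_real (cutoff s p) * (LINT t:{x..0}|lborel. cis (p * t))" for p
  proof -
    have "(LINT y|lborel. cis (p * y) * (u (1 / s) y - u s y)) =
      (LINT y|lborel. cis (p * y) * u (1 / s) y) - (LINT y|lborel. cis (p * y) * u s y)"
      unfolding right_diff_distrib using s by (intro Bochner_Integration.integral_diff int) auto
    then show ?thesis using s
      by (simp only: u_def fourier_smoothed_indicator zero_less_divide_1_iff cutoff_def of_real_diff left_diff_distrib)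
  qed
  have "schwartz (\<lambda>y. u (1 / s) y - u s y)" using s by (intro schwartz_diff sch) auto
  then have "(LINT y|lborel. g y * (u (1 / s) y - u s y)) = (LINT p:{0<..}|lborel. gt p *
    (1 / complex_of_real (sqrt (2 * pi)) * (LINT y|lborel. cis (p * y) * (u (1 / s) y - u s y))))"
    using ps unfolding position_space_def by blast
  then show ?thesis unfolding FT by (simp add: smoothed_primitive_def u_def)
qed

lemma norm_smoothed_diff_le_1:
  assumes "s > 0"
  shows "norm (complex_of_real (smoothed_indicator (1 / s) x y - smoothed_indicator s x y)) \<le> 1"
  using smoothed_indicator_bounds[of s x y] smoothed_indicator_bounds[of "1 / s" x y] assms
  unfolding norm_of_real by (simp add: abs_le_iff)

lemma smoothed_indicator_measurable:
  assumes "\<sigma> > 0" "x \<le> 0"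
  shows "smoothed_indicator \<sigma> x \<in> borel_measurable borel"
  using smoothed_indicator_has_derivative[OF assms]
  by (intro borel_measurable_continuous_onI continuous_at_imp_continuous_on) (blast intro: DERIV_isCont)

lemma norm_smoothed_primitive_le:
  assumes g: "integrable lborel g" and s: "s > 0" and x: "x \<le> 0"
  shows "norm (smoothed_primitive g s x) \<le> (LINT y|lborel. norm (g y))"
  unfolding smoothed_primitive_def
proof (rule order_trans[OF integral_norm_bound integral_mono'])
  show "norm (g y * complex_of_real (smoothed_indicator (1 / s) x y - smoothed_indicator s x y)) \<le> norm (g y)" for y
    unfolding norm_mult by (rule mult_left_le[OF norm_smoothed_diff_le_1[OF s]]) simp
qed (use g in auto)

lemma smoothed_primitive_tendsto:
  assumes g: "integrable lborel g" and x: "x \<le> 0"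
  shows "(\<lambda>n. smoothed_primitive g (real (Suc n)) x) \<longlonglongrightarrow> (LINT y:{x..0}|lborel. g y)"
  unfolding smoothed_primitive_def set_lebesgue_integral_def
proof (rule integral_dominated_convergence[where w = "\<lambda>y. norm (g y)"])
  have "AE y in lborel. y \<noteq> x" "AE y in lborel. y \<noteq> (0 :: real)"
    by (auto intro: AE_lborel_singleton)
  then show "AE y in lborel. (\<lambda>n. g y * complex_of_real (smoothed_indicator (1 / real (Suc n)) x y -
      smoothed_indicator (real (Suc n)) x y)) \<longlonglongrightarrow> indicat_real {x..0} y *\<^sub>R g y"
  proof eventually_elim
    case (elim y)
    from tendsto_mult_left[OF tendsto_of_real[OF tendsto_diff[OF smoothed_indicator_narrow[OF elim]
      smoothed_indicator_wide[of x y]]], of "g y"]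
    show ?case by (simp add: scaleR_conv_of_real mult.commute)
  qed
next
  fix n
  have s: "real (Suc n) > 0" "1 / real (Suc n) > 0" by auto
  have [measurable]: "g \<in> borel_measurable borel" using g by auto
  note [measurable] = smoothed_indicator_measurable[OF s(1) x] smoothed_indicator_measurable[OF s(2) x]
  show "(\<lambda>y. g y * complex_of_real (smoothed_indicator (1 / real (Suc n)) x y - smoothed_indicator (real (Suc n)) x y))
    \<in> borel_measurable lborel" by measurable
  show "AE y in lborel. norm (g y * complex_of_real (smoothed_indicator (1 / real (Suc n)) x y -
      smoothed_indicator (real (Suc n)) x y)) \<le> norm (g y)"
    unfolding norm_mult by (intro AE_I2 mult_left_le[OF norm_smoothed_diff_le_1[OF s(1)]]) simp
qed (use g in auto)

text \<open>This is what permits Fubini. The product splits by the arithmetic-geometric mean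
  inequality into \<open>(norm (gt k))\<^sup>2 / (4 * k)\<close> and
  \<open>(cutoff s k)\<^sup>2 / (4 * k)\<close>, and the quadratic zero of the cutoff cancels the
  singular weight.\<close>

lemma integrable_wave_cutoff:
  assumes wf: "wave_function gt" and s: "s \<ge> 1"
  shows "integrable lborel (\<lambda>k. (indicator {0<..} k *\<^sub>R gt k) * of_real (cutoff s k / (2 * k)))"
proof -
  note [measurable] = wave_functionD(1)[OF wf]
  have gt2: "integrable lborel (\<lambda>k. indicator {0<..} k *\<^sub>R ((norm (gt k))\<^sup>2 / (2 * k)))"
    using wave_functionD(2)[OF wf] by (simp add: set_integrable_def)
  \<comment> \<open>The second coefficient makes that summand equal, for \<open>k > 0\<close>, to
    \<open>1 / (4 * k)\<close> times the bound of \<open>cutoff_le\<close>.\<close>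
  define R where "R k = 1 / 2 * (indicator {0<..} k *\<^sub>R ((norm (gt k))\<^sup>2 / (2 * k))) +
    s ^ 3 * sqrt (2 * pi) / 8 * (normal_density 0 s k * \<bar>k\<bar>)" for k
  have "integrable lborel (\<lambda>k. normal_density 0 s k * \<bar>k\<bar>)"
    using integrable_normal_moment_abs[of s 0 1] s by simp
  then have R: "integrable lborel R"
    unfolding R_def by (intro Bochner_Integration.integrable_add integrable_mult_right gt2)
  show ?thesis
  proof (rule Bochner_Integration.integrable_bound[OF R])
    have "norm ((indicator {0<..} k *\<^sub>R gt k) * of_real (cutoff s k / (2 * k))) \<le> R k" for k
    proof (cases "k > 0")
      case True
      have c: "0 \<le> cutoff s k" by (rule cutoff_nonneg[OF s])
      have "(cutoff s k)\<^sup>2 \<le> cutoff s k"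
        using c cutoff_le_1[OF s, of k] by (simp add: power2_eq_square mult_left_le)
      also have "\<dots> \<le> (s * k)\<^sup>2 / 2 * exp (- (1 / s * k)\<^sup>2 / 2)" by (rule cutoff_le[OF s])
      finally have c2: "(cutoff s k)\<^sup>2 \<le> (s * k)\<^sup>2 / 2 * exp (- (1 / s * k)\<^sup>2 / 2)" .
      have nd: "s ^ 3 * sqrt (2 * pi) / 8 * (normal_density 0 s k * \<bar>k\<bar>) =
          1 / (4 * k) * ((s * k)\<^sup>2 / 2 * exp (- (1 / s * k)\<^sup>2 / 2))"
        using s True by (simp add: normal_density_def real_sqrt_mult power_divide power2_eq_square power3_eq_cube)
      have "norm (gt k) * cutoff s k * 2 \<le> (norm (gt k))\<^sup>2 + (cutoff s k)\<^sup>2"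
        using zero_le_power2[of "norm (gt k) - cutoff s k"] by (simp add: power2_eq_square algebra_simps)
      then have "norm (gt k) * cutoff s k / (2 * k) \<le> ((norm (gt k))\<^sup>2 + (cutoff s k)\<^sup>2) / (4 * k)"
        using True by (simp add: field_simps)
      also have "\<dots> = 1 / 2 * ((norm (gt k))\<^sup>2 / (2 * k)) + 1 / (4 * k) * (cutoff s k)\<^sup>2"
        using True by (simp add: field_simps)
      also have "\<dots> \<le> R k" unfolding R_def nd using True
        by (intro add_mono mult_left_mono c2) auto
      finally show ?thesis using True c by (simp add: norm_mult norm_divide)
    next
      case False
      moreover have "0 \<le> s ^ 3 * sqrt (2 * pi) / 8 * (normal_density 0 s k * \<bar>k\<bar>)"
        using s by (intro mult_nonneg_nonneg) auto
      ultimately show ?thesis by (simp add: R_def)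
    qed
    from order_trans[OF this abs_ge_self]
    show "AE k in lborel. norm ((indicator {0<..} k *\<^sub>R gt k) * of_real (cutoff s k / (2 * k))) \<le> norm (R k)"
      unfolding real_norm_def by (intro AE_I2)
  qed measurable
qed

section \<open>Bounds on the inner products\<close>

lemma integrable_norm_integral_Icc:
  fixes f g :: "real \<Rightarrow> complex"
  assumes f: "integrable lborel f" and g: "integrable lborel g" and [measurable]: "X \<in> borel_measurable borel"
  shows "integrable lborel (\<lambda>y. norm (f y) * (LINT s:{X y..0}|lborel. norm (g s)))"
proof (rule Bochner_Integration.integrable_bound)
  show "integrable lborel (\<lambda>y. norm (f y) * (LINT s|lborel. norm (g s)))"
    using f by simp
  have [measurable]: "f \<in> borel_measurable borel" "g \<in> borel_measurable borel" using f g by auto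
  have [measurable]: "(\<lambda>y. LINT s:{X y..0}|lborel. norm (g s)) \<in> borel_measurable borel"
    by (rule borel_measurable_integral_Icc) measurable
  show "(\<lambda>y. norm (f y) * (LINT s:{X y..0}|lborel. norm (g s))) \<in> borel_measurable lborel" by measurable
  have "0 \<le> (LINT s:{x..0}|lborel. norm (g s))" "(LINT s:{x..0}|lborel. norm (g s)) \<le> (LINT s|lborel. norm (g s))" for x
    unfolding set_lebesgue_integral_def using g
    by (auto intro!: integral_nonneg_AE integral_mono' simp: indicator_def)
  then show "AE y in lborel. norm (norm (f y) * (LINT s:{X y..0}|lborel. norm (g s)))
      \<le> norm (norm (f y) * (LINT s|lborel. norm (g s)))"
    by (auto simp: abs_mult intro!: mult_left_mono order_trans[OF _ abs_ge_self])
qed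

text \<open>The integral over \<open>k\<close> is cut off near \<open>0\<close> and \<open>\<infinity>\<close>, which makes Fubini's theorem
  applicable. If the uncut integral does not converge absolutely, \<open>wave_inner\<close> has the junk
  value \<open>0\<close> and the bound is trivial.\<close>

lemma norm_wave_inner_B_op_le:
  fixes gt f g :: "real \<Rightarrow> complex" and X :: "real \<Rightarrow> real"
  assumes wf: "wave_function gt" and ps: "position_space gt g" and g: "integrable lborel g"
    and f: "integrable lborel f" and f0: "(LINT y|lborel. f y) = 0"
    and X[measurable]: "X \<in> borel_measurable borel" and X0: "\<And>y. X y \<le> 0"
  shows "norm (wave_inner (\<lambda>k. cnj (gt k)) (B_op X f))
    \<le> 1 / 2 * (LINT y|lborel. norm (f y) * (LINT s:{X y..0}|lborel. norm (g s)))"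
proof -
  define c where "c = 1 / complex_of_real (sqrt (2 * pi))"
  define \<gamma> where "\<gamma> k = indicator {0<..} k *\<^sub>R gt k" for k
  define b where "b = B_op X f"
  define v where "v k = (indicator {0<..} k *\<^sub>R ((1 / (2 * k)) *\<^sub>R (gt k * b k)))" for k
  have [measurable]: "\<gamma> \<in> borel_measurable borel"
    using wave_functionD(1)[OF wf] by (simp add: \<gamma>_def[abs_def])
  have fm[measurable]: "f \<in> borel_measurable borel" and [measurable]: "g \<in> borel_measurable borel"
    using f g by auto
  have b_eq: "b k = c * (LINT y|lborel. cis (k * X y) * f y)" for k
    by (simp add: b_def B_op_def U_op_def c_def)
  have [measurable]: "b \<in> borel_measurable borel"
  proof -
    have "(\<lambda>(k, y). cis (k * X y) * f y) \<in> borel_measurable (borel \<Otimes>\<^sub>M lborel)"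
      by measurable
    from lborel.borel_measurable_lebesgue_integral[OF this]
    have "(\<lambda>k. c * (LINT y|lborel. cis (k * X y) * f y)) \<in> borel_measurable borel" by simp
    then show ?thesis by (simp add: b_eq[abs_def])
  qed
  have v_eq: "v k = \<gamma> k * of_real (1 / (2 * k)) * b k" for k
    by (simp add: v_def \<gamma>_def scaleR_conv_of_real)
  have vm[measurable]: "v \<in> borel_measurable borel" unfolding v_eq by measurable
  have "(\<lambda>k. indicator {0<..} k *\<^sub>R (gt k * b k)) \<in> borel_measurable borel"
  proof -
    have "(\<lambda>k. \<gamma> k * b k) \<in> borel_measurable borel" by measurable
    then show ?thesis by (simp add: \<gamma>_def)
  qed
  then have W: "wave_inner (\<lambda>k. cnj (gt k)) (B_op X f) = (LINT k|lborel. v k)"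
    unfolding wave_inner_def b_def[symmetric]
    by (simp add: integral_half_line_measure borel_measurable_half_line_measure_iff v_def set_lebesgue_integral_def)
  have rhs0: "0 \<le> (LINT y|lborel. norm (f y) * (LINT s:{X y..0}|lborel. norm (g s)))"
    by (intro integral_nonneg_AE AE_I2 mult_nonneg_nonneg) (auto simp: set_lebesgue_integral_def)
  show ?thesis
  proof (cases "integrable lborel v")
    case False
    then show ?thesis using rhs0 by (simp add: W not_integrable_integral_eq)
  next
    case v: True
    define s where "s n = real (Suc n)" for n
    have s: "s n \<ge> 1" "s n > 0" for n by (auto simp: s_def)
    have slim: "filterlim s at_top sequentially"
      unfolding s_def using filterlim_compose[OF filterlim_real_sequentially filterlim_Suc] .
    define T where "T n = (LINT k|lborel. of_real (cutoff (s n) k) * v k)" for n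
    have T1: "T \<longlonglongrightarrow> (LINT k|lborel. v k)"
      unfolding T_def
    proof (rule integral_dominated_convergence[where w = "\<lambda>k. norm (v k)"])
      show "AE k in lborel. (\<lambda>n. of_real (cutoff (s n) k) * v k) \<longlonglongrightarrow> v k"
      proof (rule AE_I2)
        fix k
        show "(\<lambda>n. of_real (cutoff (s n) k) * v k) \<longlonglongrightarrow> v k"
        proof (cases "k > 0")
          case True
          have "(\<lambda>n. cutoff (s n) k) \<longlonglongrightarrow> 1"
            unfolding cutoff_def using True by (intro filterlim_compose[OF _ slim]) real_asymp
          from tendsto_mult_right[OF tendsto_of_real[OF this], of "v k"] show ?thesis by simp
        qed (simp add: v_def)
      qed
      show "AE k in lborel. norm (of_real (cutoff (s n) k) * v k) \<le> norm (v k)" for n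
        using cutoff_nonneg[OF s(1)[of n]] cutoff_le_1[OF s(1)[of n]]
        by (auto simp: norm_mult intro!: mult_left_le_one_le)
    qed (use v in auto)
    define w where "w n k = \<gamma> k * of_real (cutoff (s n) k / (2 * k))" for n k
    have w: "integrable lborel (w n)" for n
      unfolding w_def \<gamma>_def by (rule integrable_wave_cutoff[OF wf s(1)])
    have [measurable]: "w n \<in> borel_measurable borel" for n using w[of n] by auto
    \<comment> \<open>Pointwise, \<open>(cis (k * x) - 1) / (2 * k)\<close> is
      \<open>- \<i> / 2\<close> times the integral of \<open>cis (k * t)\<close> over
      \<open>{x..0}\<close>, for \<open>k > 0\<close> and \<open>x \<le> 0\<close>.\<close>
    have inner: "(LINT k|lborel. w n k * c * (cis (k * X y) - 1)) = - \<i> / 2 * smoothed_primitive g (s n) (X y)" for n y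
    proof -
      have "- \<i> / 2 * smoothed_primitive g (s n) (X y) = (LINT k|lborel. - \<i> / 2 * (indicator {0<..} k *\<^sub>R (gt k *
        (c * (of_real (cutoff (s n) k) * (LINT t:{X y..0}|lborel. cis (k * t)))))))"
        unfolding smoothed_primitive_eq[OF ps s(2) X0] c_def set_lebesgue_integral_def[of _ "{0<..}"]
        by (rule integral_mult_right_zero[symmetric])
      also have "\<dots> = (LINT k|lborel. w n k * c * (cis (k * X y) - 1))"
      proof (intro Bochner_Integration.integral_cong refl)
        fix k
        have cis: "(LINT t:{X y..0}|lborel. cis (k * t)) = (1 - cis (k * X y)) / (\<i> * of_real k)" if "k > 0"
          using that by (intro integral_cis_interval X0) auto
        show "- \<i> / 2 * (indicator {0<..} k *\<^sub>R (gt k *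
          (c * (of_real (cutoff (s n) k) * (LINT t:{X y..0}|lborel. cis (k * t)))))) = w n k * c * (cis (k * X y) - 1)"
          by (cases "k > 0") (simp_all only: cis w_def \<gamma>_def, simp_all add: field_simps)
      qed
      finally show ?thesis by simp
    qed
    have hm[measurable]: "(\<lambda>y. smoothed_primitive g (s n) (X y)) \<in> borel_measurable borel" for n
    proof -
      have "(\<lambda>(y, k). w n k * c * (cis (k * X y) - 1)) \<in> borel_measurable (borel \<Otimes>\<^sub>M lborel)"
        by measurable
      from lborel.borel_measurable_lebesgue_integral[OF this]
      have "(\<lambda>y. 2 * \<i> * (LINT k|lborel. w n k * c * (cis (k * X y) - 1))) \<in> borel_measurable borel" by simp
      then show ?thesis by (simp add: inner)
    qed
    have T_eq: "T n = - \<i> / 2 * (LINT y|lborel. f y * smoothed_primitive g (s n) (X y))" for n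
    proof -
      \<comment> \<open>The subtracted 1 costs nothing, since the integral of \<open>f\<close> over
        \<open>y\<close> vanishes, and it produces the factor that \<open>inner\<close> evaluates
        when \<open>k\<close> is integrated first.\<close>
      define K where "K k y = w n k * c * (cis (k * X y) - 1) * f y" for k y
      have P: "integrable (lborel \<Otimes>\<^sub>M lborel) (\<lambda>(k, y). (2 * norm c) * (w n k * f y))"
        by (rule lborel_pair.Fubini_integrable) (use f w[of n] in \<open>auto simp: norm_mult\<close>)
      have K: "integrable (lborel \<Otimes>\<^sub>M lborel) (\<lambda>(k, y). K k y)"
      proof (rule Bochner_Integration.integrable_bound[OF P])
        show "(\<lambda>(k, y). K k y) \<in> borel_measurable (lborel \<Otimes>\<^sub>M lborel)" unfolding K_def by measurable
        have "norm (K k y) \<le> norm ((2 * norm c) * (w n k * f y))" for k y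
        proof -
          have "norm (cis (k * X y) - 1) \<le> 2"
            using norm_triangle_ineq4[of "cis (k * X y)" 1] by simp
          then have "norm (cis (k * X y) - 1) * (norm (w n k) * norm c * norm (f y)) \<le> 2 * (norm (w n k) * norm c * norm (f y))"
            by (intro mult_right_mono) auto
          then show ?thesis by (simp add: K_def norm_mult mult_ac)
        qed
        then show "AE z in lborel \<Otimes>\<^sub>M lborel. norm (case z of (k, y) \<Rightarrow> K k y)
          \<le> norm (case z of (k, y) \<Rightarrow> (2 * norm c) * (w n k * f y))" by auto
      qed
      have "of_real (cutoff (s n) k) * v k = (LINT y|lborel. K k y)" for k
      proof -
        have i: "integrable lborel (\<lambda>y. cis (k * X y) * f y)"
          by (rule Bochner_Integration.integrable_bound[OF f]) (auto simp: norm_mult)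
        have "(LINT y|lborel. K k y) = w n k * c * (LINT y|lborel. cis (k * X y) * f y - f y)"
          unfolding K_def integral_mult_right_zero[symmetric] by (simp add: algebra_simps)
        also have "\<dots> = w n k * b k"
          using i f by (simp add: f0 b_eq)
        finally show ?thesis by (simp add: w_def v_eq)
      qed
      then have "T n = (LINT k|lborel. LINT y|lborel. K k y)" by (simp add: T_def)
      also have "\<dots> = (LINT y|lborel. LINT k|lborel. K k y)"
        using lborel_pair.Fubini_integral[OF K] by simp
      also have "\<dots> = (LINT y|lborel. - \<i> / 2 * (f y * smoothed_primitive g (s n) (X y)))"
        unfolding K_def integral_mult_left_zero inner
        by (intro Bochner_Integration.integral_cong refl) simp
      finally show ?thesis unfolding integral_mult_right_zero .
    qed
    define H where "H x = (LINT s:{x..0}|lborel. g s)" for x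
    have [measurable]: "(\<lambda>y. H (X y)) \<in> borel_measurable borel"
      unfolding H_def by (rule borel_measurable_integral_Icc) measurable
    \<comment> \<open>The two smoothed indicators differ by at most 1, so the integral of
      \<open>norm (g s)\<close> bounds all regularised primitives, uniformly in \<open>n\<close> and
      \<open>y\<close>.\<close>
    have "(\<lambda>n. LINT y|lborel. f y * smoothed_primitive g (s n) (X y)) \<longlonglongrightarrow> (LINT y|lborel. f y * H (X y))"
    proof (rule integral_dominated_convergence[where w = "\<lambda>y. norm (f y) * (LINT s|lborel. norm (g s))"])
      show "AE y in lborel. (\<lambda>n. f y * smoothed_primitive g (s n) (X y)) \<longlonglongrightarrow> f y * H (X y)"
        unfolding H_def s_def by (intro AE_I2 tendsto_mult_left smoothed_primitive_tendsto[OF g X0])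
      show "AE y in lborel. norm (f y * smoothed_primitive g (s n) (X y)) \<le> norm (f y) * (LINT s|lborel. norm (g s))" for n
        unfolding norm_mult by (intro AE_I2 mult_left_mono norm_smoothed_primitive_le g s X0) auto
    qed (use f in auto)
    from tendsto_mult_left[OF this, of "- \<i> / 2"]
    have "T \<longlonglongrightarrow> - \<i> / 2 * (LINT y|lborel. f y * H (X y))"
      unfolding T_eq[abs_def] .
    \<comment> \<open>Both limits of \<open>T\<close> together give an exact formula for the inner
      product; absolute values are taken only after this point.\<close>
    with T1 have "(LINT k|lborel. v k) = - \<i> / 2 * (LINT y|lborel. f y * H (X y))"
      by (rule LIMSEQ_unique)
    then have "norm (wave_inner (\<lambda>k. cnj (gt k)) (B_op X f)) = 1 / 2 * norm (LINT y|lborel. f y * H (X y))"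
      by (simp add: W norm_mult norm_divide)
    also have "norm (LINT y|lborel. f y * H (X y)) \<le> (LINT y|lborel. norm (f y * H (X y)))"
      by (rule integral_norm_bound)
    also have "\<dots> \<le> (LINT y|lborel. norm (f y) * (LINT s:{X y..0}|lborel. norm (g s)))"
    proof (rule integral_mono'[OF integrable_norm_integral_Icc[OF f g X]])
      show "norm (f y * H (X y)) \<le> norm (f y) * (LINT s:{X y..0}|lborel. norm (g s))" for y
        unfolding norm_mult H_def set_lebesgue_integral_def
        by (intro mult_left_mono order_trans[OF integral_norm_bound]) auto
    qed (intro mult_nonneg_nonneg, auto simp: set_lebesgue_integral_def)
    finally show ?thesis by simp
  qed
qed

text \<open>Conjugating \<open>f\<close> exchanges the roles of the two operators up to conjugation.
  The estimate for \<open>B_op\<close> asks of \<open>f\<close> only integrability and a vanishing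
  integral, both stable under conjugation, so it covers \<open>A_op\<close> as well.\<close>

lemma wave_inner_A_op:
  "norm (wave_inner gt (A_op X f)) = norm (wave_inner (\<lambda>k. cnj (gt k)) (B_op X (\<lambda>y. cnj (f y))))"
proof -
  have "B_op X (\<lambda>y. cnj (f y)) k = cnj (A_op X f k)" for k
  proof -
    have "(LINT y|lborel. cis (k * X y) * cnj (f y)) = cnj (LINT y|lborel. cis (- (k * X y)) * f y)"
      unfolding Bochner_Integration.integral_cnj[symmetric] by (simp add: cis_cnj)
    then show ?thesis by (simp add: B_op_def A_op_def U_op_def)
  qed
  then have "wave_inner (\<lambda>k. cnj (gt k)) (B_op X (\<lambda>y. cnj (f y))) =
      (LINT k|half_line_measure. cnj (cnj (gt k) * A_op X f k))"
    by (simp add: wave_inner_def del: Bochner_Integration.integral_cnj)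
  also have "\<dots> = cnj (wave_inner gt (A_op X f))"
    unfolding wave_inner_def by (rule Bochner_Integration.integral_cnj)
  finally show ?thesis by simp
qed

text \<open>Each inner product is bounded by half of the same integral; the two squares add up to
  the factor 1/2.\<close>

lemma N_diff_le:
  fixes gt f g :: "real \<Rightarrow> complex" and X :: "real \<Rightarrow> real"
  assumes wf: "wave_function gt" and ps: "position_space gt g" and g: "integrable lborel g"
    and f: "integrable lborel f" and f0: "(LINT y|lborel. f y) = 0"
    and X: "X \<in> borel_measurable borel" and X0: "\<And>y. X y \<le> 0"
  shows "N_diff X gt f \<le> 1 / 2 * (LINT y|lborel. norm (f y) * (LINT s:{X y..0}|lborel. norm (g s)))\<^sup>2"
proof -
  let ?I = "LINT y|lborel. norm (f y) * (LINT s:{X y..0}|lborel. norm (g s))"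
  have B: "norm (wave_inner (\<lambda>k. cnj (gt k)) (B_op X f)) \<le> 1 / 2 * ?I"
    by (rule norm_wave_inner_B_op_le[OF wf ps g f f0 X X0])
  have "(LINT y|lborel. cnj (f y)) = 0" by (simp add: f0)
  from norm_wave_inner_B_op_le[OF wf ps g _ this X X0]
  have A: "norm (wave_inner gt (A_op X f)) \<le> 1 / 2 * ?I"
    using f by (simp add: wave_inner_A_op)
  have "N_diff X gt f \<le> (1 / 2 * ?I)\<^sup>2 + (1 / 2 * ?I)\<^sup>2"
    unfolding N_diff_def by (intro add_mono power_mono A B) auto
  then show ?thesis by (simp add: power2_eq_square)
qed

section \<open>Tail estimates and the limit of large time shifts\<close>

lemma powr_tail_integral_le:
  fixes f :: "real \<Rightarrow> complex"
  assumes f: "integrable lborel f" and a: "\<alpha> > 0" and C: "C > 0" and M: "M > 0"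
    and bnd: "AE y in lborel. y \<le> - M \<longrightarrow> norm (f y) \<le> C / \<bar>y\<bar> powr (1 + \<alpha>)"
  shows "(LINT y:{..- M}|lborel. norm (f y)) \<le> C / (\<alpha> * M powr \<alpha>)"
proof -
  \<comment> \<open>The tail is computed on \<open>{M..}\<close> with the primitive
    \<open>- C / \<alpha> * x powr (- \<alpha>)\<close> and then reflected to the negative
    axis.\<close>
  have nn: "(\<integral>\<^sup>+ x. ennreal (C * x powr (- 1 - \<alpha>)) * indicator {M..} x \<partial>lborel) =
      ennreal (0 - - C / \<alpha> * M powr (- \<alpha>))"
  proof (rule nn_integral_FTC_atLeast)
    show "DERIV (\<lambda>x. - C / \<alpha> * x powr (- \<alpha>)) x :> C * x powr (- 1 - \<alpha>)" if "M \<le> x" for x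
      using that M a by (auto intro!: derivative_eq_intros simp: field_simps powr_diff powr_minus)
    show "((\<lambda>x. - C / \<alpha> * x powr (- \<alpha>)) \<longlongrightarrow> 0) at_top"
      using a by real_asymp
  qed (use C M in auto)
  have hb: "has_bochner_integral lborel (\<lambda>x. indicator {M..} x * (C * x powr (- 1 - \<alpha>))) (C / \<alpha> * M powr (- \<alpha>))"
  proof (rule has_bochner_integral_nn_integral)
    show "(\<integral>\<^sup>+ x. ennreal (indicator {M..} x * (C * x powr (- 1 - \<alpha>))) \<partial>lborel) = ennreal (C / \<alpha> * M powr (- \<alpha>))"
      using nn C by (simp add: ennreal_mult' ennreal_indicator mult.commute)
  qed (use C a in auto)
  have hb': "has_bochner_integral lborel (\<lambda>y. indicator {M..} (- y) * (C * (- y) powr (- 1 - \<alpha>))) (C / \<alpha> * M powr (- \<alpha>))"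
    using lborel_has_bochner_integral_real_affine_iff[of "- 1" "\<lambda>x. indicator {M..} x * (C * x powr (- 1 - \<alpha>))" _ 0] hb by simp
  have "(LINT y:{..- M}|lborel. norm (f y)) \<le> (LINT y|lborel. indicator {M..} (- y) * (C * (- y) powr (- 1 - \<alpha>)))"
    unfolding set_lebesgue_integral_def
  proof (rule integral_mono_AE)
    show "AE y in lborel. indicator {..- M} y *\<^sub>R norm (f y) \<le> indicator {M..} (- y) * (C * (- y) powr (- 1 - \<alpha>))"
      using bnd
    proof eventually_elim
      case (elim y)
      show ?case
      proof (cases "y \<le> - M")
        case True
        then have "C / \<bar>y\<bar> powr (1 + \<alpha>) = C * (- y) powr (- 1 - \<alpha>)"
          using M powr_minus_divide[of "- y" "1 + \<alpha>"] by simp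
        then show ?thesis using elim True by simp
      qed auto
    qed
    show "integrable lborel (\<lambda>y. indicator {..- M} y *\<^sub>R norm (f y))"
      using f by (intro integrable_mult_indicator) auto
  qed (rule integrable.intros[OF hb'])
  also have "\<dots> = C / (\<alpha> * M powr \<alpha>)"
    using has_bochner_integral_integral_eq[OF hb'] by (simp add: powr_minus field_simps)
  finally show ?thesis .
qed

text \<open>The first bound serves the early \<open>y\<close>, where \<open>x\<close> may be large
  in modulus; the second gains a factor \<open>- x\<close> close to 0. The value of \<open>g\<close>
  at 0 is uncontrolled, but one point is a null set.\<close>

lemma integral_Icc_le_half_line:
  fixes g :: "real \<Rightarrow> complex"
  assumes g: "integrable lborel g" and d: "d < 0" "K \<ge> 0" "\<And>s. d < s \<Longrightarrow> s < 0 \<Longrightarrow> norm (g s) \<le> K"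
    and x: "x \<le> 0"
  shows "(LINT s:{x..0}|lborel. norm (g s)) \<le> (LINT s:{..<0}|lborel. norm (g s))"
    and "d < x \<Longrightarrow> (LINT s:{x..0}|lborel. norm (g s)) \<le> K * - x"
proof -
  have i: "integrable lborel (\<lambda>s. indicator A s *\<^sub>R norm (g s))" if "A \<in> sets lborel" for A
    using g that by (intro integrable_mult_indicator) auto
  have ne: "AE s in lborel. s \<noteq> (0 :: real)" by (rule AE_lborel_singleton)
  show "(LINT s:{x..0}|lborel. norm (g s)) \<le> (LINT s:{..<0}|lborel. norm (g s))"
    unfolding set_lebesgue_integral_def
  proof (rule integral_mono_AE)
    show "AE s in lborel. indicator {x..0} s *\<^sub>R norm (g s) \<le> indicator {..<0} s *\<^sub>R norm (g s)"
      using ne by eventually_elim (auto simp: indicator_def)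
  qed (use i in simp_all)
  assume dx: "d < x"
  have "(LINT s:{x..0}|lborel. norm (g s)) \<le> (LINT s:{x..0}|lborel. K)"
    unfolding set_lebesgue_integral_def
  proof (rule integral_mono_AE)
    show "AE s in lborel. indicator {x..0} s *\<^sub>R norm (g s) \<le> indicator {x..0} s *\<^sub>R K"
      using ne by eventually_elim (use d dx in \<open>auto simp: indicator_def\<close>)
  qed (use i integrable_const_Icc[of x 0 K] in simp_all)
  also have "\<dots> = K * - x" using x by (simp add: set_lebesgue_integral_def)
  finally show "(LINT s:{x..0}|lborel. norm (g s)) \<le> K * - x" .
qed

text \<open>The constant \<open>K\<close> bounds \<open>g\<close> near \<open>0\<^sup>-\<close>; any such bound will do, because the
  contribution of late \<open>y\<close> decays exponentially in \<open>y0\<close> and is eventually absorbed by the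
  factor \<open>4\<close> in the polynomially decaying first term.\<close>

lemma eventually_N_diff_le:
  fixes gt f g :: "real \<Rightarrow> complex" and X :: "real \<Rightarrow> real"
  assumes wf: "wave_function gt" and ps: "position_space gt g" and g: "integrable lborel g"
    and f: "integrable lborel f" and f0: "(LINT y|lborel. f y) = 0"
    and lim: "(g \<longlongrightarrow> g0) (at_left 0)"
    and a: "\<alpha> > 0" and C: "C > 0" and L: "L \<ge> 0"
    and bnd: "AE y in lborel. y \<le> - L \<longrightarrow> norm (f y) \<le> C / \<bar>y\<bar> powr (1 + \<alpha>)"
    and X: "X \<in> borel_measurable borel" and X0: "\<And>y. X y \<le> 0" and Xe: "\<And>y. - exp (- y) \<le> X y"
  shows "\<forall>\<^sub>F y0 in at_top. N_diff X gt (\<lambda>y. f (y - y0))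
    \<le> (LINT s:{..<0}|lborel. norm (g s))\<^sup>2 * (4 * C\<^sup>2 / (\<alpha>\<^sup>2 * (y0 / 2 + L) powr (2 * \<alpha>)))"
proof -
  define \<Gamma> where "\<Gamma> = (LINT s:{..<0}|lborel. norm (g s))"
  define F where "F = (LINT y|lborel. norm (f y))"
  define G where "G x = (LINT s:{x..0}|lborel. norm (g s))" for x
  \<comment> \<open>Any constant above \<open>norm g0\<close> bounds \<open>g\<close> on some
    interval \<open>(d, 0)\<close>.\<close>
  define K where "K = norm g0 + 1"
  have \<Gamma>0: "0 \<le> \<Gamma>" and F0: "0 \<le> F" and G0: "0 \<le> G x" and K0: "0 \<le> K" for x
    by (auto simp: \<Gamma>_def F_def G_def K_def set_lebesgue_integral_def)
  have "\<forall>\<^sub>F s in at_left 0. norm (g s) < K"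
    by (rule order_tendstoD(2)[OF tendsto_norm[OF lim]]) (simp add: K_def)
  then obtain d where d: "d < 0" "\<And>s. d < s \<Longrightarrow> s < 0 \<Longrightarrow> norm (g s) \<le> K"
    unfolding eventually_at_left_field by (auto intro: less_imp_le)
  have G1: "G (X y) \<le> \<Gamma>" for y
    unfolding G_def \<Gamma>_def by (rule integral_Icc_le_half_line(1)[OF g d(1) K0 d(2) X0])
  have G2: "G (X y) \<le> K * - X y" if "d < X y" for y
    unfolding G_def by (rule integral_Icc_le_half_line(2)[OF g d(1) K0 d(2) X0 that])
  have I: "(LINT y|lborel. norm (f (y - y0)) * G (X y)) \<le>
      \<Gamma> * (C / (\<alpha> * (y0 / 2 + L) powr \<alpha>)) + K * exp (L - y0 / 2) * F"
    if y0: "y0 > 0" "exp (L - y0 / 2) < - d" for y0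
  proof -
    \<comment> \<open>The split \<open>y - y0 = - M\<close> balances two demands:
      \<open>M \<ge> L\<close> puts the early part inside the range of the decay bound, and later
      \<open>y\<close> satisfy \<open>exp (- y) < exp (L - y0 / 2)\<close>.\<close>
    define M where "M = y0 / 2 + L"
    have M: "M > 0" "M \<ge> L" using y0 L by (auto simp: M_def)
    have sh: "integrable lborel (\<lambda>y. f (y - y0))" 
      using lborel_integrable_real_affine[OF f, of 1 "- y0"] by simp
    have shn: "integrable lborel (\<lambda>y. norm (f (y - y0)))" using sh by simp
    \<comment> \<open>The late bound is added for every \<open>y\<close>, which makes its integral
      simply a multiple of \<open>F\<close>.\<close>
    define R where "R y = \<Gamma> * (indicator {..- M} (y - y0) *\<^sub>R norm (f (y - y0))) + K * exp (L - y0 / 2) * norm (f (y - y0))" for y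
    have ind: "integrable lborel (\<lambda>y. indicator {..- M} y *\<^sub>R norm (f y))"
      using f by (intro integrable_mult_indicator) auto
    have indsh: "integrable lborel (\<lambda>y. indicator {..- M} (y - y0) *\<^sub>R norm (f (y - y0)))"
      using lborel_integrable_real_affine[OF ind, of 1 "- y0"] by simp
    have "(LINT y|lborel. norm (f (y - y0)) * G (X y)) \<le> (LINT y|lborel. R y)"
    proof (rule integral_mono)
      show "integrable lborel (\<lambda>y. norm (f (y - y0)) * G (X y))"
        unfolding G_def by (rule integrable_norm_integral_Icc[OF sh g X])
      show "integrable lborel R" unfolding R_def
        by (intro Bochner_Integration.integrable_add integrable_mult_right indsh shn)
      show "norm (f (y - y0)) * G (X y) \<le> R y" for y
      proof (cases "y - y0 \<le> - M")
        case True
        have "norm (f (y - y0)) * G (X y) \<le> norm (f (y - y0)) * \<Gamma>"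
          by (intro mult_left_mono G1) auto
        moreover have "0 \<le> K * exp (L - y0 / 2) * norm (f (y - y0))" using K0 by simp
        ultimately show ?thesis using True by (simp add: R_def mult.commute)
      next
        case False
        then have "exp (- y) \<le> exp (L - y0 / 2)" by (simp add: M_def)
        then have e: "- X y \<le> exp (L - y0 / 2)" using Xe[of y] by linarith
        then have "d < X y" using y0(2) by linarith
        then have "G (X y) \<le> K * - X y" by (rule G2)
        also have "\<dots> \<le> K * exp (L - y0 / 2)" by (rule mult_left_mono[OF e K0])
        finally have "norm (f (y - y0)) * G (X y) \<le> norm (f (y - y0)) * (K * exp (L - y0 / 2))"
          by (rule mult_left_mono) simp
        then show ?thesis using False by (simp add: R_def mult_ac)
      qed
    qed
    also have "\<dots> = \<Gamma> * (LINT y|lborel. indicator {..- M} (y - y0) *\<^sub>R norm (f (y - y0)))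
        + K * exp (L - y0 / 2) * (LINT y|lborel. norm (f (y - y0)))"
      unfolding R_def using indsh shn by (subst Bochner_Integration.integral_add) auto
    also have "(LINT y|lborel. norm (f (y - y0))) = F"
      using lborel_integral_real_affine[of 1 "\<lambda>y. norm (f y)" "- y0"] by (simp add: F_def)
    also have "(LINT y|lborel. indicator {..- M} (y - y0) *\<^sub>R norm (f (y - y0))) =
        (LINT y:{..- M}|lborel. norm (f y))"
      using lborel_integral_real_affine[of 1 "\<lambda>y. indicator {..- M} y *\<^sub>R norm (f y)" "- y0"]
      by (simp add: set_lebesgue_integral_def)
    finally have le: "(LINT y|lborel. norm (f (y - y0)) * G (X y)) \<le>
       \<Gamma> * (LINT y:{..- M}|lborel. norm (f y)) + K * exp (L - y0 / 2) * F" .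
    have "AE y in lborel. y \<le> - M \<longrightarrow> norm (f y) \<le> C / \<bar>y\<bar> powr (1 + \<alpha>)"
      using bnd by eventually_elim (use M in auto)
    from powr_tail_integral_le[OF f a C M(1) this]
    have "\<Gamma> * (LINT y:{..- M}|lborel. norm (f y)) \<le> \<Gamma> * (C / (\<alpha> * M powr \<alpha>))"
      by (rule mult_left_mono[OF _ \<Gamma>0])
    with le show ?thesis by (simp add: M_def)
  qed
  have N: "N_diff X gt (\<lambda>y. f (y - y0)) \<le> 1 / 2 * (LINT y|lborel. norm (f (y - y0)) * G (X y))\<^sup>2" for y0
  proof -
    have sh: "integrable lborel (\<lambda>y. f (y - y0))"
      using lborel_integrable_real_affine[OF f, of 1 "- y0"] by simp
    have "(LINT y|lborel. f (y - y0)) = 0"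
      using lborel_integral_real_affine[of 1 f "- y0"] f0 by simp
    from N_diff_le[OF wf ps g sh this X X0] show ?thesis by (simp add: G_def)
  qed
  have ev: "\<forall>\<^sub>F y0 in at_top. exp (L - y0 / 2) < - d" "\<forall>\<^sub>F y0 :: real in at_top. y0 > 0"
    using d(1) by real_asymp+
  show ?thesis
  \<comment> \<open>Absorbing the late part needs a positive early bound. If
    \<open>\<Gamma> = 0\<close>, then \<open>G (X y)\<close> vanishes for all \<open>y\<close> and
    there is nothing to absorb.\<close>
  proof (cases "\<Gamma> = 0")
    case True
    then have "G (X y) = 0" for y using G1[of y] G0[of "X y"] by simp
    then show ?thesis using N by (simp add: True flip: \<Gamma>_def)
  next
    case False
    then have "\<Gamma> * C / \<alpha> > 0" using \<Gamma>0 C a by simp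
    \<comment> \<open>The exponential beats the power, so the late part is eventually at most the
      early bound \<open>?a\<close>.\<close>
    moreover have "((\<lambda>y0. exp (L - y0 / 2) * (y0 / 2 + L) powr \<alpha>) \<longlongrightarrow> 0) at_top"
      using a by real_asymp
    from tendsto_mult_right_zero[OF this, of "K * F"]
    have "((\<lambda>y0. K * F * (exp (L - y0 / 2) * (y0 / 2 + L) powr \<alpha>)) \<longlongrightarrow> 0) at_top" .
    ultimately have "\<forall>\<^sub>F y0 in at_top. K * F * (exp (L - y0 / 2) * (y0 / 2 + L) powr \<alpha>) < \<Gamma> * C / \<alpha>"
      by (rule order_tendstoD(2)[rotated])
    then have "\<forall>\<^sub>F y0 in at_top. K * exp (L - y0 / 2) * F \<le> \<Gamma> * C / \<alpha> / (y0 / 2 + L) powr \<alpha>"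
      using ev(2)
    proof eventually_elim
      case (elim y0)
      then have "(y0 / 2 + L) powr \<alpha> > 0" using L by simp
      from pos_le_divide_eq[OF this] show ?case using elim(1) by (simp only:) (simp add: mult_ac)
    qed
    then show ?thesis using ev unfolding \<Gamma>_def[symmetric]
    proof eventually_elim
      case (elim y0)
      let ?a = "\<Gamma> * (C / (\<alpha> * (y0 / 2 + L) powr \<alpha>))"
      have "(LINT y|lborel. norm (f (y - y0)) * G (X y)) \<le> ?a + K * exp (L - y0 / 2) * F"
        by (rule I) (use elim in auto)
      also have "\<dots> \<le> 2 * ?a"
      proof -
        have "K * exp (L - y0 / 2) * F \<le> ?a" using elim(1) by simp
        then show ?thesis unfolding mult_2 by (rule add_left_mono)
      qed
      finally have "(LINT y|lborel. norm (f (y - y0)) * G (X y))\<^sup>2 \<le> (2 * ?a)\<^sup>2"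
        by (rule power_mono) (intro integral_nonneg_AE AE_I2 mult_nonneg_nonneg G0 norm_ge_zero)
      with N[of y0] have "N_diff X gt (\<lambda>y. f (y - y0)) \<le> 2 * ?a\<^sup>2" by (simp add: power2_eq_square)
      \<comment> \<open>With both parts at most \<open>?a\<close>, the factor 1/2 of
        \<open>N_diff_le\<close> gives \<open>2 * ?a\<^sup>2\<close>, which leaves a factor 2 to
        spare.\<close>
      also have "\<dots> \<le> 4 * ?a\<^sup>2" by simp
      also have "\<dots> = \<Gamma>\<^sup>2 * (4 * C\<^sup>2 / (\<alpha>\<^sup>2 * (y0 / 2 + L) powr (2 * \<alpha>)))"
      proof -
        have "(y0 / 2 + L) powr (2 * \<alpha>) = ((y0 / 2 + L) powr \<alpha>)\<^sup>2"
          unfolding power2_eq_square powr_add[symmetric] by simp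
        then show ?thesis by (simp add: power_mult_distrib power_divide)
      qed
      finally show ?case .
    qed
  qed
qed

theorem theorem13:
  fixes ft gt f g :: "real \<Rightarrow> complex" and g0 :: complex and \<alpha> C L :: real
  assumes "wave_function ft" and "normalized ft"
    and "wave_function gt" and "normalized gt"
    and "position_space ft f" and "integrable lborel f"
    and "position_space gt g" and "integrable lborel g"
    and "(g \<longlongrightarrow> g0) (at_left 0)"
    and "\<alpha> > 0" and "C > 0" and "L \<ge> 0"
    and "AE y in lborel. y \<le> - L \<longrightarrow> norm (f y) \<le> C / \<bar>y\<bar> powr (1 + \<alpha>)"
  shows "\<forall>x\<in>{relativistic_bh, cghs_bh}. \<forall>\<^sub>F y0 in at_top.
    \<bar>N_diff x gt (\<lambda>y. f (y - y0))\<bar>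
      \<le> (LINT s:{..<0}|lborel. norm (g s))\<^sup>2 * (4 * C\<^sup>2 / (\<alpha>\<^sup>2 * (y0 / 2 + L) powr (2 * \<alpha>)))
        + exp (2 * L - y0) * (LINT y|lborel. norm (f y))\<^sup>2 * (norm g0)\<^sup>2"
proof
  fix x assume x: "x \<in> {relativistic_bh, cghs_bh}"
  have X: "x \<in> borel_measurable borel"
    using x unfolding relativistic_bh_def cghs_bh_def by auto
  have X0: "x y \<le> 0" for y
    using x by (auto simp: relativistic_bh_def cghs_bh_def)
  \<comment> \<open>Both models lie between \<open>- exp (- y)\<close> and 0; for the CGHS model
    this is \<open>ln (1 + t) \<le> t\<close>. The estimate is uniform over all measurable models
    with these bounds.\<close>
  have Xe: "- exp (- y) \<le> x y" for y
    using x ln_add_one_self_le_self[of "exp (- y)"] by (auto simp: relativistic_bh_def cghs_bh_def)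
  have "(LINT y|lborel. f y) = 0"
    using assms by (intro position_space_integral_zero)
  from eventually_N_diff_le[OF assms(3,7,8,6) this assms(9-13) X X0 Xe]
  show "\<forall>\<^sub>F y0 in at_top. \<bar>N_diff x gt (\<lambda>y. f (y - y0))\<bar>
      \<le> (LINT s:{..<0}|lborel. norm (g s))\<^sup>2 * (4 * C\<^sup>2 / (\<alpha>\<^sup>2 * (y0 / 2 + L) powr (2 * \<alpha>)))
        + exp (2 * L - y0) * (LINT y|lborel. norm (f y))\<^sup>2 * (norm g0)\<^sup>2"
  proof eventually_elim
    case (elim y0)
    have "0 \<le> N_diff x gt (\<lambda>y. f (y - y0))" by (simp add: N_diff_def)
    moreover have "0 \<le> exp (2 * L - y0) * (LINT y|lborel. norm (f y))\<^sup>2 * (norm g0)\<^sup>2" by simp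
    ultimately show ?case using elim by linarith
  qed
qed

end
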